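(* Let $\lambda$ be a frequency and $k>\ell\ge 0$. Then for every bounded set $M\subset H_{\infty,\ell}^{\lambda}[\mathrm{Re}>0]$ and every choice of $\varepsilon,u>0$ there is $x_0>0$ such that $$\sup_{x>x_0}\ \sup_{f\in M}\ \|f(u+\cdot)-R_x^{\lambda,k}(f)(u+\cdot)\|_{\infty,\ell}\le\varepsilon.$$
   Context: A frequency is a strictly increasing sequence $\lambda=(\lambda_n)_{n\ge 1}$ of non-negative real numbers with $\lambda_n\to\infty$. A $\lambda$-Dirichlet series is a formal series $D=\sum a_n e^{-\lambda_n s}$ with complex coefficients $a_n$. Write $[\mathrm{Re}>\sigma]=\{s\in\mathbb{C}:\mathrm{Re}\,s>\sigma\}$. A $\lambda$-Dirichlet series $D=\sum a_ne^{-\lambda_ns}$ is a $\lambda$-Riesz germ of a holomorphic function $f:[\mathrm{Re}>0]\to\mathbb{C}$ if for some $m\ge 0$ and some $\sigma\ge 0$ one has $f(s)=\lim_{x\to\infty}\sum_{\lambda_n<x}a_ne^{-\lambda_ns}\big(1-\frac{\lambda_n}{x}\big)^m$ for all $s\in[\mathrm{Re}>\sigma]$. A $\lambda$-Riesz germ, if it exists, is unique, and one writes $a_n(f):=a_n$. For such $f$, $k\ge 0$, $x>0$ and $s\in\mathbb{C}$ put $R_x^{\lambda,k}(f)(s)=\sum_{\lambda_n<x}a_n(f)e^{-\lambda_ns}\big(1-\frac{\lambda_n}{x}\big)^k$. For $\ell\ge 0$, $H_{\infty,\ell}^{\lambda}[\mathrm{Re}>0]$ is the linear space of all holomorphic $f:[\mathrm{Re}>0]\to\mathbb{C}$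 which have a $\lambda$-Riesz germ and satisfy $\|f\|_{\infty,\ell}=\sup_{\mathrm{Re}\,s>0}\frac{|f(s)|}{(1+|s|)^{\ell}}<\infty$. Here $f(u+\cdot)$ denotes the function $s\mapsto f(u+s)$; boundedness of $M$ is with respect to $\|\cdot\|_{\infty,\ell}$. *)

theory Defs
  imports "HOL-Complex_Analysis.Complex_Analysis"
begin

(* Sequences are indexed from 0: lambda_1, a_1, ... become lam 0, a 0, ... *)
definition frequency :: "(nat \<Rightarrow> real) \<Rightarrow> bool" where
  "frequency lam \<longleftrightarrow> strict_mono lam \<and> (\<forall>n. 0 \<le> lam n) \<and> filterlim lam at_top sequentially"

definition right_halfplane :: "real \<Rightarrow> complex set" where
  "right_halfplane \<sigma> = {s. \<sigma> < Re s}"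

(* A Dirichlet series is represented by its coefficient sequence a. For a frequency lam
   the index set is finite, and for x > 0 the base of powr is positive on it, so the
   exponent k = 0 gives the ordinary partial sums. *)
definition riesz_mean ::
    "(nat \<Rightarrow> real) \<Rightarrow> (nat \<Rightarrow> complex) \<Rightarrow> real \<Rightarrow> real \<Rightarrow> complex \<Rightarrow> complex" where
  "riesz_mean lam a k x s =
     (\<Sum>n | lam n < x. a n * exp (- of_real (lam n) * s) * of_real ((1 - lam n / x) powr k))"

definition riesz_germ :: "(nat \<Rightarrow> real) \<Rightarrow> (nat \<Rightarrow> complex) \<Rightarrow> (complex \<Rightarrow> complex) \<Rightarrow> bool" where
  "riesz_germ lam a f \<longleftrightarrow>
     (\<exists>m\<ge>0. \<exists>\<sigma>\<ge>0. \<forall>s\<in>right_halfplane \<sigma>. ((\<lambda>x. riesz_mean lam a m x s) \<longlongrightarrow> f s) at_top)"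

(* Meaningful when f is holomorphic on Re > 0 and has a (necessarily unique) Riesz germ. *)
definition riesz_coeff :: "(nat \<Rightarrow> real) \<Rightarrow> (complex \<Rightarrow> complex) \<Rightarrow> nat \<Rightarrow> complex" where
  "riesz_coeff lam f = (THE a. riesz_germ lam a f)"

definition riesz_mean_of ::
    "(nat \<Rightarrow> real) \<Rightarrow> real \<Rightarrow> real \<Rightarrow> (complex \<Rightarrow> complex) \<Rightarrow> complex \<Rightarrow> complex" where
  "riesz_mean_of lam k x f s = riesz_mean lam (riesz_coeff lam f) k x s"

(* Extended-valued, so that an infinite supremum is not confused with a junk real value. *)
definition norm_inf :: "real \<Rightarrow> (complex \<Rightarrow> complex) \<Rightarrow> ennreal" where
  "norm_inf l f = (SUP s\<in>right_halfplane 0. ennreal (cmod (f s) / (1 + cmod s) powr l))"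

(* Functions are total on the complex plane; only their values on Re > 0 matter. *)
definition H_inf :: "(nat \<Rightarrow> real) \<Rightarrow> real \<Rightarrow> (complex \<Rightarrow> complex) set" where
  "H_inf lam l = {f. f holomorphic_on right_halfplane 0 \<and> (\<exists>a. riesz_germ lam a f) \<and> norm_inf l f < \<infinity>}"

end

(* For Re w > 0 and c > 0 Perron's formula reads
     I * x^k * R_x^k(f)(w) = integral of f(w + z) e^(xz) z^(-1-k) over the line Re z = c,
   where I is the value of the same integral with f = 1, x = 1. Subtracting the constant f(w),
     I * x^k * (f(w) - R_x^k(f)(w)) = integral of (f(w) - f(w + z)) e^(xz) z^(-1-k),
   and on the line Re z = 1/x the factor e^(xz) is bounded. For Re w >= u the increment is at most
   a constant times (1 + |w|)^l (|z|^p + |z|^q) with 0 < p <= 1, q >= l and p, q < k, by a Cauchy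
   estimate for small z and by the growth of f for large z; scaling gives a bound O(x^-p + x^-q).

   Perron's formula for large k follows by dominated convergence from the formula for Dirichlet
   polynomials: the Riesz means of integer order N of the germ converge to f on a half plane and
   grow at most like |s|^(N+1) there. Differentiating in x lowers k one by one as long as k > l.
   The formula also shows that the germ is determined by f. *)
theory Submission
  imports Defs "HOL-Probability.Probability"
begin

section \<open>Integrals over vertical lines\<close>

text \<open>Subtracting f(w) is what creates decay: on Re z = 1/x the kernel e^(xz) z^(-1-k) has
  absolute integral of order x^k, so bounding f alone would only give bounded Riesz means, while an
  extra factor |z|^p gains x^-p. Exponents p < 1 are needed because k may be at most 1: the
  Lipschitz factor |z| is then not integrable against |z|^(-1-k) along the line.

  The germ converges only pointwise, which gives no dominating function on a vertical line.
  Convergence at a single real point bounds the means there for all x > 0, and an exact identity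
  carries this bound to all points at least 1 further right. The identity involves the (N + 1)-st
  power of an integral operator, hence the passage to integer orders, which rests on Beta averages
  of means of lower order.

  Classically I = 2 pi / Gamma(k + 1). Only I \<noteq> 0 and the recursion between k and k + 1
  enter, and both come from the integral itself: the first by Fourier inversion with Gaussian
  weights, the second by differentiating the kernel.\<close>

lemma integrable_shifted_abs_powr:
  fixes a c :: real
  assumes "1 < a" "0 < c"
  shows "integrable lborel (\<lambda>t. (c + \<bar>t\<bar>) powr - a)"
proof -
  let ?g = "\<lambda>t::real. indicator {0..} t *\<^sub>R ((c + \<bar>t\<bar>) powr - a)"
  have nn: "(\<integral>\<^sup>+t. ennreal ((c + \<bar>t\<bar>) powr - a) * indicator {0..} t \<partial>lborel)
      = ennreal (0 - (- ((c + 0) powr (1 - a)) / (a - 1)))"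
  proof (rule nn_integral_FTC_atLeast)
    show "((\<lambda>t. - ((c + t) powr (1 - a)) / (a - 1)) has_real_derivative (c + \<bar>x\<bar>) powr - a) (at x)"
      if "0 \<le> x" for x
    proof -
      have "((\<lambda>t. - ((c + t) powr (1 - a)) / (a - 1)) has_real_derivative
          - ((1 - a) * (c + x) powr (1 - a - 1)) / (a - 1)) (at x)"
        using assms that by (auto intro!: derivative_eq_intros)
      moreover have "- ((1 - a) * (c + x) powr (1 - a - 1)) / (a - 1) = (c + \<bar>x\<bar>) powr - a"
        using assms that by (simp add: divide_simps) (simp add: algebra_simps)
      ultimately show ?thesis by simp
    qed
    have "((\<lambda>t::real. (c + t) powr (1 - a)) \<longlongrightarrow> 0) at_top"
    proof (rule tendsto_neg_powr)
      show "LIM x at_top. c + x :> at_top"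
        by (rule filterlim_tendsto_add_at_top[OF tendsto_const filterlim_ident])
    qed (use assms in auto)
    from tendsto_divide[OF tendsto_minus[OF this] tendsto_const, of "a - 1"] assms
    show "((\<lambda>t. - ((c + t) powr (1 - a)) / (a - 1)) \<longlongrightarrow> 0) at_top"
      by simp
  qed auto
  have g: "integrable lborel ?g"
  proof (rule integrableI_nonneg)
    have "(\<integral>\<^sup>+t. ennreal (?g t) \<partial>lborel)
        = (\<integral>\<^sup>+t. ennreal ((c + \<bar>t\<bar>) powr - a) * indicator {0..} t \<partial>lborel)"
      by (intro nn_integral_cong) (auto simp: indicator_def)
    then show "(\<integral>\<^sup>+t. ennreal (?g t) \<partial>lborel) < \<infinity>"
      unfolding nn by simp
  qed auto
  have g': "integrable lborel (\<lambda>t. ?g (- t))"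
    using lborel_integrable_real_affine[OF g, of "-1" 0] by simp
  show ?thesis
  proof (rule Bochner_Integration.integrable_bound)
    show "integrable lborel (\<lambda>t. ?g t + ?g (- t))"
      using g g' by (rule Bochner_Integration.integrable_add)
  qed (auto simp: indicator_def)
qed

lemma cmod_Complex_lower: "0 < c \<Longrightarrow> (c + \<bar>t\<bar>) / 2 \<le> cmod (Complex c t)"
  using abs_Re_le_cmod[of "Complex c t"] abs_Im_le_cmod[of "Complex c t"] by simp

lemma Complex_measurable [measurable]: "Complex c \<in> borel_measurable borel"
proof -
  have "continuous_on UNIV (Complex c)"
    by (auto intro!: continuous_intros simp: Complex_eq[abs_def])
  then show ?thesis by (rule borel_measurable_continuous_onI)
qed

lemma integrable_cmod_line_powr:
  assumes "1 < a" "0 < c"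
  shows "integrable lborel (\<lambda>t. cmod (Complex c t) powr - a)"
proof (rule Bochner_Integration.integrable_bound)
  show "integrable lborel (\<lambda>t. 2 powr a * (c + \<bar>t\<bar>) powr - a)"
    using integrable_shifted_abs_powr[OF assms] by simp
  have "cmod (Complex c t) powr - a \<le> 2 powr a * (c + \<bar>t\<bar>) powr - a" for t
  proof -
    have "cmod (Complex c t) powr - a \<le> ((c + \<bar>t\<bar>) / 2) powr - a"
      by (rule powr_mono2') (use assms cmod_Complex_lower[of c t] in auto)
    also have "\<dots> = 2 powr a * (c + \<bar>t\<bar>) powr - a"
      using assms by (simp add: powr_divide powr_minus field_simps)
    finally show ?thesis .
  qed
  then show "AE t in lborel. norm (cmod (Complex c t) powr - a) \<le> norm (2 powr a * (c + \<bar>t\<bar>) powr - a)"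
    by (intro AE_I2) simp
qed measurable

text \<open>Substituting c * t for t pulls the factor c out of every point of the line. With c = 1 /
  x this produces the powers of x in the final estimate; with c tending to infinity it makes the
  kernel vanish for y <= 0.\<close>

lemma integral_cmod_line_powr_scale:
  assumes "0 < c"
  shows "(LINT t|lborel. cmod (Complex c t) powr - a) = c powr (1 - a) * (LINT t|lborel. cmod (Complex 1 t) powr - a)"
proof -
  have "(LINT t|lborel. cmod (Complex c t) powr - a) = \<bar>c\<bar> *\<^sub>R (LINT t|lborel. cmod (Complex c (0 + c * t)) powr - a)"
    by (rule lborel_integral_real_affine) (use assms in auto)
  also have "(\<lambda>t. cmod (Complex c (0 + c * t)) powr - a) = (\<lambda>t. c powr - a * cmod (Complex 1 t) powr - a)"
  proof
    fix t
    have "Complex c (0 + c * t) = of_real c * Complex 1 t"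
      by (simp add: complex_eq_iff)
    then show "cmod (Complex c (0 + c * t)) powr - a = c powr - a * cmod (Complex 1 t) powr - a"
      using assms by (simp add: norm_mult powr_mult)
  qed
  also have "\<bar>c\<bar> *\<^sub>R (LINT t|lborel. c powr - a * cmod (Complex 1 t) powr - a)
      = (c powr 1 * c powr - a) * (LINT t|lborel. cmod (Complex 1 t) powr - a)"
    using assms by simp
  also have "c powr 1 * c powr - a = c powr (1 - a)"
    by (subst powr_add[symmetric]) simp
  finally show ?thesis .
qed

lemma holomorphic_line_measurable:
  assumes "F holomorphic_on {z. 0 < Re z}" "0 < c"
  shows "(\<lambda>t. F (Complex c t)) \<in> borel_measurable borel"
proof -
  have "continuous_on UNIV (\<lambda>t. F (Complex c t))"
    by (rule continuous_on_compose2[OF holomorphic_on_imp_continuous_on[OF assms(1)]])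
       (use assms in \<open>auto intro!: continuous_intros simp: Complex_eq[abs_def]\<close>)
  then show ?thesis by (rule borel_measurable_continuous_onI)
qed

lemma line_integrable:
  assumes "F holomorphic_on {z. 0 < Re z}" "0 < c" "1 < a"
    and "\<And>t. cmod (F (Complex c t)) \<le> C * cmod (Complex c t) powr - a"
  shows "integrable lborel (\<lambda>t. F (Complex c t))"
proof (rule Bochner_Integration.integrable_bound)
  show "integrable lborel (\<lambda>t. C * cmod (Complex c t) powr - a)"
    using integrable_cmod_line_powr[OF assms(3,2)] by simp
  show "(\<lambda>t. F (Complex c t)) \<in> borel_measurable lborel"
    using holomorphic_line_measurable[OF assms(1,2)] by simp
  show "AE t in lborel. norm (F (Complex c t)) \<le> norm (C * cmod (Complex c t) powr - a)"
    using assms(4) by (intro AE_I2) (simp add: order_trans[OF _ abs_ge_self])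
qed

text \<open>Cauchy's theorem for the rectangle between the two lines and the heights -T and T: the
  horizontal sides are O(T^-a) and vanish as T tends to infinity, while the vertical sides tend to
  the full integrals.\<close>

lemma line_integral_shift:
  assumes hol: "F holomorphic_on {z. 0 < Re z}" and c: "0 < c1" "c1 < c2" and a: "1 < a"
    and bd: "\<And>z. c1 \<le> Re z \<Longrightarrow> Re z \<le> c2 \<Longrightarrow> cmod (F z) \<le> C * cmod z powr - a"
  shows "(LINT t|lborel. F (Complex c1 t)) = (LINT t|lborel. F (Complex c2 t))"
proof -
  define H where "H = (\<lambda>c T. LINT t:{-T..T}|lborel. F (Complex c t))"
  have lim: "((\<lambda>T. H c T) \<longlongrightarrow> (LINT t|lborel. F (Complex c t))) at_top"
    if "c1 \<le> c" "c \<le> c2" for c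
  proof -
    have i: "integrable lborel (\<lambda>t. F (Complex c t))"
      by (rule line_integrable[OF hol _ a, where C = C]) (use c that bd in auto)
    show ?thesis
      unfolding H_def set_lebesgue_integral_def
    proof (rule integral_dominated_convergence_at_top)
      show "(\<lambda>t. F (Complex c t)) \<in> borel_measurable lborel"
        using i by simp
      then show "(\<lambda>t. indicator {- T..T} t *\<^sub>R F (Complex c t)) \<in> borel_measurable lborel" for T :: real
        by simp
      show "integrable lborel (\<lambda>t. cmod (F (Complex c t)))" using i by simp
      show "AE t in lborel. ((\<lambda>T. indicator {- T..T} t *\<^sub>R F (Complex c t)) \<longlongrightarrow> F (Complex c t)) at_top"
      proof (intro AE_I2 tendsto_eventually)
        fix t :: real
        show "\<forall>\<^sub>F T in at_top. indicator {- T..T} t *\<^sub>R F (Complex c t) = F (Complex c t)"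
          using eventually_ge_at_top[of "\<bar>t\<bar>"] by eventually_elim (auto simp: indicator_def)
      qed
      show "\<forall>\<^sub>F T in at_top. AE t in lborel. cmod (indicator {- T..T} t *\<^sub>R F (Complex c t)) \<le> cmod (F (Complex c t))"
        by (auto simp: indicator_def)
    qed
  qed
  \<comment> \<open>The sign of C is read off from the bound at the real point c1.\<close>
  have C0: "0 \<le> C"
  proof -
    have "0 \<le> C * cmod (of_real c1) powr - a"
      by (rule order_trans[OF norm_ge_zero bd]) (use c in auto)
    then show ?thesis using c by (simp add: zero_le_mult_iff)
  qed
  have diff: "cmod (H c1 T - H c2 T) \<le> 2 * C * (c2 - c1) * T powr - a" if T: "0 < T" for T
  proof -
    let ?a1 = "Complex c1 (-T)" and ?a2 = "Complex c2 (-T)" and ?a3 = "Complex c2 T" and ?a4 = "Complex c1 T"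
    have cont: "continuous_on {z. 0 < Re z} F" by (rule holomorphic_on_imp_continuous_on[OF hol])
    have conv: "convex {z. 0 < Re z}" by (rule convex_halfspace_Re_gt)
    have seg: "closed_segment x y \<subseteq> {z. 0 < Re z}" if "0 < Re x" "0 < Re y" for x y
      using closed_segment_subset[OF _ _ conv, of x y] that by simp
    have ci: "F contour_integrable_on linepath x y" if "0 < Re x" "0 < Re y" for x y
      by (rule contour_integrable_continuous_linepath) (use continuous_on_subset[OF cont seg] that in auto)
    have "(F has_contour_integral 0) (rectpath ?a1 ?a3)"
    proof (rule Cauchy_theorem_convex_simple[OF hol conv])
      show "path_image (rectpath ?a1 ?a3) \<subseteq> {z. 0 < Re z}"
        using path_image_rectpath_subset_cbox[of ?a1 ?a3] c T by (force simp: in_cbox_complex_iff)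
    qed auto
    then have "contour_integral (rectpath ?a1 ?a3) F = 0" by (rule contour_integral_unique)
    then have z: "contour_integral (linepath ?a1 ?a2) F + (contour_integral (linepath ?a2 ?a3) F
        + (contour_integral (linepath ?a3 ?a4) F + contour_integral (linepath ?a4 ?a1) F)) = 0"
      unfolding rectpath_def Let_def using c ci
      by (simp add: contour_integrable_joinI)
    have v: "contour_integral (linepath (Complex c (-T)) (Complex c T)) F = \<i> * H c T" if "c1 \<le> c" "c \<le> c2" for c
    proof -
      have c0: "0 < c" using c that by simp
      have "continuous_on {-T..T} (\<lambda>t. F (Complex c t))"
        by (rule continuous_on_compose2[OF cont])
           (use c0 in \<open>auto intro!: continuous_intros simp: Complex_eq[abs_def]\<close>)
      then have "integral {-T..T} (\<lambda>t. F (Complex c t)) = H c T"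
        unfolding H_def using borel_integrable_atLeastAtMost' set_borel_integral_eq_integral(2) by metis
      then show ?thesis
        using T by (subst contour_integral_linepath_same_Re[where c = c and a = "-T" and b = T]) auto
    qed
    have v4: "contour_integral (linepath ?a4 ?a1) F = - (\<i> * H c1 T)"
      using contour_integral_reverse_linepath[of ?a4 ?a1 F] v[of c1] c
        continuous_on_subset[OF cont seg[of ?a4 ?a1]] by simp
    \<comment> \<open>One bound serves both horizontal sides: the set equation admits either
      direction of travel, and the absolute value of s either height.\<close>
    have hb: "cmod (contour_integral (linepath (Complex x s) (Complex y s)) F) \<le> C * T powr - a * (c2 - c1)"
      if xy: "{x, y} = {c1, c2}" and s: "\<bar>s\<bar> = T" for x y s
    proof -
      have "cmod (contour_integral (linepath (Complex x s) (Complex y s)) F)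
          \<le> C * T powr - a * cmod (Complex y s - Complex x s)"
      proof (rule contour_integral_bound_linepath)
        show "F contour_integrable_on linepath (Complex x s) (Complex y s)"
          by (rule ci) (use xy c in \<open>auto simp: doubleton_eq_iff\<close>)
        fix z assume "z \<in> closed_segment (Complex x s) (Complex y s)"
        then have z: "Im z = s" "c1 \<le> Re z" "Re z \<le> c2"
        proof -
          assume "z \<in> closed_segment (Complex x s) (Complex y s)"
          then obtain r where r: "0 \<le> r" "r \<le> 1" "z = (1 - r) *\<^sub>R Complex x s + r *\<^sub>R Complex y s"
            by (auto simp: closed_segment_def)
          have "Re z \<in> closed_segment x y"
            using r by (auto simp: closed_segment_def)
          then show "c1 \<le> Re z" "Re z \<le> c2"
            using xy c by (auto simp: doubleton_eq_iff closed_segment_eq_real_ivl split: if_splits)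
          have "Im z = (1 - r) * s + r * s" using r(3) by simp
          then show "Im z = s" by (simp add: algebra_simps)
        qed
        have "cmod (F z) \<le> C * cmod z powr - a" by (rule bd) (use z in auto)
        also have "\<dots> \<le> C * T powr - a"
          using abs_Im_le_cmod[of z] z s T a C0 by (intro mult_left_mono powr_mono2') auto
        finally show "cmod (F z) \<le> C * T powr - a" .
      qed (use C0 in auto)
      also have "Complex y s - Complex x s = of_real (y - x)" by (simp add: complex_eq_iff)
      also have "cmod (of_real (y - x)) = c2 - c1"
        using xy c by (auto simp: doubleton_eq_iff abs_if simp flip: of_real_diff)
      finally show ?thesis .
    qed
    have e: "\<i> * (H c1 T - H c2 T) = contour_integral (linepath ?a1 ?a2) F + contour_integral (linepath ?a3 ?a4) F"
      using z v[of c2] v4 c by (simp add: algebra_simps add_eq_0_iff)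
    have "cmod (\<i> * (H c1 T - H c2 T)) \<le> C * T powr - a * (c2 - c1) + C * T powr - a * (c2 - c1)"
      unfolding e by (intro norm_triangle_mono hb) (use T in auto)
    then have "cmod (H c1 T - H c2 T) \<le> C * T powr - a * (c2 - c1) + C * T powr - a * (c2 - c1)"
      by (simp only: norm_mult norm_ii mult_1)
    then show ?thesis by (simp add: algebra_simps)
  qed
  have "((\<lambda>T. H c1 T - H c2 T) \<longlongrightarrow> 0) at_top"
  proof (rule Lim_null_comparison)
    show "\<forall>\<^sub>F T in at_top. cmod (H c1 T - H c2 T) \<le> 2 * C * (c2 - c1) * T powr - a"
      using eventually_gt_at_top[of 0] by eventually_elim (rule diff)
    have "((\<lambda>T::real. T powr - a) \<longlongrightarrow> 0) at_top"
      by (rule tendsto_neg_powr[OF _ filterlim_ident]) (use a in auto)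
    from tendsto_mult[OF tendsto_const this]
    show "((\<lambda>T. 2 * C * (c2 - c1) * T powr - a) \<longlongrightarrow> 0) at_top" by simp
  qed
  moreover have "((\<lambda>T. H c1 T - H c2 T) \<longlongrightarrow> (LINT t|lborel. F (Complex c1 t)) - (LINT t|lborel. F (Complex c2 t))) at_top"
    by (intro tendsto_diff lim) (use c in auto)
  ultimately show ?thesis
    using tendsto_unique[OF trivial_limit_at_top_linorder] by fastforce
qed

section \<open>The Perron kernel\<close>

text \<open>This is 2 pi times the inverse Laplace transform of z^(-k-1) at y, classically 2 pi y^k
  / Gamma(k + 1) for y > 0 and 0 for y <= 0. The closed form is avoided; the value at y = 1 is
  carried along as a constant.\<close>

definition perron_kernel :: "real \<Rightarrow> real \<Rightarrow> real \<Rightarrow> complex" where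
  "perron_kernel k c y =
     (LINT t|lborel. exp (of_real y * Complex c t) * Complex c t powr of_real (- k - 1))"

lemma powr_holomorphic_halfplane: "(\<lambda>z. z powr of_real a) holomorphic_on {z. 0 < Re z}"
  by (intro holomorphic_intros) (auto simp: complex_nonpos_Reals_iff)

lemma perron_integrand_holomorphic:
  "(\<lambda>z. exp (of_real y * z) * z powr of_real a) holomorphic_on {z. 0 < Re z}"
  by (intro holomorphic_intros powr_holomorphic_halfplane)

lemma cmod_perron_integrand:
  "cmod (exp (of_real y * z) * z powr of_real (- k - 1)) = exp (y * Re z) * cmod z powr - (k + 1)"
  by (simp add: norm_mult norm_powr_real_powr')

lemma perron_kernel_integrable:
  assumes "0 < k" "0 < c"
  shows "integrable lborel (\<lambda>t. exp (of_real y * Complex c t) * Complex c t powr of_real (- k - 1))"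
  by (rule line_integrable[OF perron_integrand_holomorphic, where a = "k + 1" and C = "exp (y * c)"])
     (use assms in \<open>auto simp: norm_mult norm_powr_real_powr'\<close>)

lemma perron_kernel_indep:
  assumes "0 < k" "0 < c" "0 < c'"
  shows "perron_kernel k c y = perron_kernel k c' y"
proof -
  have *: "perron_kernel k c y = perron_kernel k c' y" if "0 < c" "c < c'" for c c'
    unfolding perron_kernel_def
  proof (rule line_integral_shift[OF perron_integrand_holomorphic that, where a = "k + 1"
        and C = "exp (\<bar>y\<bar> * c')"])
    fix z assume "c \<le> Re z" "Re z \<le> c'"
    then have "y * Re z \<le> \<bar>y\<bar> * c'"
      using that by (intro mult_mono) auto
    then show "cmod (exp (of_real y * z) * z powr of_real (- k - 1)) \<le> exp (\<bar>y\<bar> * c') * cmod z powr - (k + 1)"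
      unfolding cmod_perron_integrand by (intro mult_right_mono) auto
  qed (use assms in auto)
  then show ?thesis
    using assms by (cases c c' rule: linorder_cases) (auto simp: *)
qed

text \<open>For y <= 0 the factor exp (y * z) has modulus at most 1 on every line Re z = d > 0, so
  the kernel is bounded by a constant times d^-k. Independence of the line allows d to tend to
  infinity.\<close>

lemma perron_kernel_nonpos:
  assumes "0 < k" "0 < c" "y \<le> 0"
  shows "perron_kernel k c y = 0"
proof -
  define B where "B = (LINT t|lborel. cmod (Complex 1 t) powr - (k + 1))"
  have le: "cmod (perron_kernel k c y) \<le> d powr - k * B" if d: "0 < d" for d
  proof -
    have "cmod (perron_kernel k c y) = cmod (perron_kernel k d y)"
      using perron_kernel_indep assms d by metis
    also have "\<dots> \<le> (LINT t|lborel. cmod (exp (of_real y * Complex d t) * Complex d t powr of_real (- k - 1)))"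
      unfolding perron_kernel_def by (rule integral_norm_bound)
    also have "\<dots> \<le> (LINT t|lborel. cmod (Complex d t) powr - (k + 1))"
    proof (rule integral_mono)
      show "integrable lborel (\<lambda>t. cmod (Complex d t) powr - (k + 1))"
        by (rule integrable_cmod_line_powr) (use assms d in auto)
      show "cmod (exp (of_real y * Complex d t) * Complex d t powr of_real (- k - 1)) \<le> cmod (Complex d t) powr - (k + 1)" for t
        unfolding cmod_perron_integrand using assms d by (intro mult_left_le_one_le) (auto simp: mult_nonpos_nonneg)
    qed (use perron_kernel_integrable[OF assms(1) d] in simp)
    also have "\<dots> = d powr - k * B"
      using d by (subst integral_cmod_line_powr_scale) (auto simp: B_def)
    finally show ?thesis .
  qed
  have "((\<lambda>d. d powr - k * B) \<longlongrightarrow> 0 * B) at_top"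
    by (intro tendsto_mult tendsto_neg_powr filterlim_ident tendsto_const) (use assms in auto)
  then have "cmod (perron_kernel k c y) \<le> 0 * B"
    by (rule tendsto_lowerbound) (auto intro!: eventually_mono[OF eventually_gt_at_top[of 0]] le)
  then show ?thesis by simp
qed

lemma powr_times_of_real:
  fixes z :: complex
  assumes "0 < r"
  shows "(of_real r * z) powr of_real a = of_real (r powr a) * z powr of_real a"
  using assms by (subst powr_times_real_left) (auto simp: powr_of_real)

text \<open>The line may be moved to Re z = 1 / y, where substituting t / y for t turns y * z into
  the variable on Re z = 1. The power contributes y^(k+1) and the Jacobian 1 / y.\<close>

lemma perron_kernel_pos:
  assumes "0 < k" "0 < c" "0 < y"
  shows "perron_kernel k c y = of_real (y powr k) * perron_kernel k 1 1"
proof -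
  have "perron_kernel k c y = perron_kernel k (1 / y) y"
    using assms by (intro perron_kernel_indep) auto
  also have "\<dots> = \<bar>1 / y\<bar> *\<^sub>R (LINT t|lborel. exp (of_real y * Complex (1 / y) (0 + 1 / y * t)) * Complex (1 / y) (0 + 1 / y * t) powr of_real (- k - 1))"
    unfolding perron_kernel_def by (rule lborel_integral_real_affine) (use assms in auto)
  also have "(\<lambda>t. exp (of_real y * Complex (1 / y) (0 + 1 / y * t)) * Complex (1 / y) (0 + 1 / y * t) powr of_real (- k - 1))
      = (\<lambda>t. of_real (y powr (k + 1)) * (exp (of_real 1 * Complex 1 t) * Complex 1 t powr of_real (- k - 1)))"
  proof
    fix t
    have 1: "Complex (1 / y) (0 + 1 / y * t) = of_real (1 / y) * Complex 1 t"
      by (simp add: complex_eq_iff)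
    have 2: "of_real y * (of_real (1 / y) * Complex 1 t) = of_real 1 * Complex 1 t"
      using assms by simp
    have 3: "(1 / y) powr (- k - 1) = y powr (k + 1)"
      using assms by (simp add: powr_divide add.commute flip: powr_minus_divide)
    show "exp (of_real y * Complex (1 / y) (0 + 1 / y * t)) * Complex (1 / y) (0 + 1 / y * t) powr of_real (- k - 1)
        = of_real (y powr (k + 1)) * (exp (of_real 1 * Complex 1 t) * Complex 1 t powr of_real (- k - 1))"
      unfolding 1 2 using assms by (subst powr_times_of_real) (auto simp only: 3 mult_ac divide_pos_pos zero_less_one)
  qed
  also have "\<bar>1 / y\<bar> *\<^sub>R (LINT t|lborel. of_real (y powr (k + 1)) * (exp (of_real 1 * Complex 1 t) * Complex 1 t powr of_real (- k - 1)))
      = of_real (1 / y * y powr (k + 1)) * perron_kernel k 1 1"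
    using assms by (simp add: perron_kernel_def scaleR_conv_of_real)
  also have "1 / y * y powr (k + 1) = (1 / y * y) * y powr k"
    using assms powr_add[of y k 1] by (simp only: powr_one less_imp_le mult_ac)
  also have "\<dots> = y powr k"
    using assms by simp
  finally show ?thesis .
qed

lemma perron_kernel_eq:
  assumes "0 < k" "0 < c"
  shows "perron_kernel k c y = of_real (max 0 y powr k) * perron_kernel k 1 1"
  using perron_kernel_pos[OF assms, of y] perron_kernel_nonpos[OF assms, of y]
  by (cases "0 < y") (auto simp: max_def)

text \<open>By scaling, a zero at y = 1 would make the kernel vanish for all real y, so the Fourier
  transform of \<phi>(t) = (1 + i t)^(-k-1) would be zero. Testing with ever narrower Gaussians then
  gives \<phi>(0) = 0, whereas \<phi>(0) = 1.\<close>

lemma perron_kernel_nonzero: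
  assumes k: "0 < k"
  shows "perron_kernel k 1 1 \<noteq> 0"
proof
  assume z: "perron_kernel k 1 1 = 0"
  define \<phi> where "\<phi> = (\<lambda>t. Complex 1 t powr of_real (- k - 1))"
  have \<phi>_int: "integrable lborel \<phi>"
    using perron_kernel_integrable[OF k, of 1 0] by (simp add: \<phi>_def)
  have \<phi>_m [measurable]: "\<phi> \<in> borel_measurable borel"
    using \<phi>_int by auto
  have \<phi>_le: "cmod (\<phi> t) \<le> 1" for t
  proof -
    have "cmod (\<phi> t) = cmod (Complex 1 t) powr (- (k + 1))"
      by (simp add: \<phi>_def norm_powr_real_powr')
    also have "\<dots> \<le> 1 powr (- (k + 1))"
      using k abs_Re_le_cmod[of "Complex 1 t"] by (intro powr_mono2') auto
    finally show ?thesis by simp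
  qed
  \<comment> \<open>On Re z = 1 the exponential splits into the constant exp y and a pure Fourier
    factor.\<close>
  have fourier0: "(LINT t|lborel. \<phi> t * iexp (t * y)) = 0" for y
  proof -
    have "0 = perron_kernel k 1 y"
      by (subst perron_kernel_eq) (use k z in auto)
    also have "\<dots> = (LINT t|lborel. exp (of_real y) * (\<phi> t * iexp (t * y)))"
      unfolding perron_kernel_def
    proof (rule Bochner_Integration.integral_cong)
      fix t
      have "exp (of_real y * Complex 1 t) = exp (of_real y) * iexp (t * y)"
        by (simp add: Complex_eq algebra_simps flip: exp_add)
      then show "exp (of_real y * Complex 1 t) * Complex 1 t powr of_real (- k - 1) = exp (of_real y) * (\<phi> t * iexp (t * y))"
        by (simp add: \<phi>_def)
    qed simp
    finally show ?thesis by simp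
  qed
  interpret N: prob_space std_normal_distribution
    by (rule real_distribution.axioms(1)) (rule real_dist_normal_dist)
  interpret P: pair_sigma_finite lborel std_normal_distribution ..
  \<comment> \<open>The Gaussian weight is the characteristic function of the standard normal law,
    so Fubini turns the weighted integral into an average of Fourier integrals, all of which
    vanish.\<close>
  have gauss0: "(LINT t|lborel. \<phi> t * of_real (exp (- ((s * t)\<^sup>2) / 2))) = 0" for s
  proof -
    have "(LINT t|lborel. \<phi> t * of_real (exp (- ((s * t)\<^sup>2) / 2)))
        = (LINT t|lborel. \<phi> t * char std_normal_distribution (s * t))"
      by (simp add: char_std_normal_distribution)
    also have "\<dots> = (LINT t|lborel. LINT y|std_normal_distribution. \<phi> t * iexp (s * t * y))"
      by (simp add: char_def)
    also have "\<dots> = (LINT y|std_normal_distribution. LINT t|lborel. \<phi> t * iexp (s * t * y))"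
    proof (rule P.Fubini_integral[symmetric])
      show "integrable (lborel \<Otimes>\<^sub>M std_normal_distribution) (\<lambda>(t, y). \<phi> t * iexp (s * t * y))"
      proof (rule P.Fubini_integrable)
        show "(\<lambda>(t, y). \<phi> t * iexp (s * t * y)) \<in> borel_measurable (lborel \<Otimes>\<^sub>M std_normal_distribution)"
          by measurable
        show "integrable lborel (\<lambda>t. LINT y|std_normal_distribution. cmod (case (t, y) of (t, y) \<Rightarrow> \<phi> t * iexp (s * t * y)))"
          using \<phi>_int by (simp add: norm_mult)
        show "AE t in lborel. integrable std_normal_distribution (\<lambda>y. case (t, y) of (t, y) \<Rightarrow> \<phi> t * iexp (s * t * y))"
        proof (intro AE_I2)
          fix t
          show "integrable std_normal_distribution (\<lambda>y. case (t, y) of (t, y) \<Rightarrow> \<phi> t * iexp (s * t * y))"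
            by (rule N.integrable_const_bound[where B = "cmod (\<phi> t)"]) (auto simp: norm_mult)
        qed
      qed
    qed
    also have "\<dots> = (LINT y|std_normal_distribution. 0)"
      using fourier0[of "s * y" for y] by (simp add: mult_ac)
    finally show ?thesis by simp
  qed
  \<comment> \<open>With s = n + 1 and r = s t the weight no longer depends on n, and \<phi> is
    evaluated at r / (n + 1), which tends to 0.\<close>
  have scaled0: "(LINT r|lborel. \<phi> (inverse (Suc n) * r) * of_real (exp (- (r\<^sup>2) / 2))) = 0" for n
  proof -
    have "0 = (LINT t|lborel. \<phi> t * of_real (exp (- ((Suc n * t)\<^sup>2) / 2)))"
      by (rule gauss0[symmetric])
    also have "\<dots> = \<bar>inverse (Suc n)\<bar> *\<^sub>R (LINT r|lborel. \<phi> (0 + inverse (Suc n) * r) * of_real (exp (- ((Suc n * (0 + inverse (Suc n) * r))\<^sup>2) / 2)))"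
      by (rule lborel_integral_real_affine) simp
    also have "(\<lambda>r. \<phi> (0 + inverse (Suc n) * r) * of_real (exp (- ((Suc n * (0 + inverse (Suc n) * r))\<^sup>2) / 2)))
       = (\<lambda>r. \<phi> (inverse (Suc n) * r) * of_real (exp (- (r\<^sup>2) / 2)))"
    proof
      fix r :: real
      have e: "Suc n * (0 + inverse (Suc n) * r) = r" by (simp add: field_simps)
      show "\<phi> (0 + inverse (Suc n) * r) * of_real (exp (- ((Suc n * (0 + inverse (Suc n) * r))\<^sup>2) / 2))
          = \<phi> (inverse (Suc n) * r) * of_real (exp (- (r\<^sup>2) / 2))"
        unfolding e by simp
    qed
    finally show ?thesis by simp
  qed
  have gi: "integrable lborel (\<lambda>r::real. exp (- (r\<^sup>2) / 2))"
    and gv: "(LINT r|lborel. exp (- (r\<^sup>2) / 2)) = sqrt (2 * pi)"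
  proof -
    have "integrable lborel (\<lambda>x. sqrt (2 * pi) * std_normal_density x)"
      by simp
    then show "integrable lborel (\<lambda>r::real. exp (- (r\<^sup>2) / 2))"
      by (simp add: std_normal_density_def)
    have "(LINT x|lborel. sqrt (2 * pi) * std_normal_density x) = sqrt (2 * pi)"
      by simp
    then show "(LINT r|lborel. exp (- (r\<^sup>2) / 2)) = sqrt (2 * pi)"
      by (simp add: std_normal_density_def)
  qed
  have "(\<lambda>n. LINT r|lborel. \<phi> (inverse (Suc n) * r) * of_real (exp (- (r\<^sup>2) / 2)))
      \<longlonglongrightarrow> (LINT r|lborel. of_real (exp (- (r\<^sup>2) / 2)))"
  proof (rule integral_dominated_convergence[OF _ _ gi])
    show "AE r in lborel. (\<lambda>n. \<phi> (inverse (Suc n) * r) * of_real (exp (- (r\<^sup>2) / 2))) \<longlonglongrightarrow> of_real (exp (- (r\<^sup>2) / 2))"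
    proof (intro AE_I2)
      fix r :: real
      have c: "isCont \<phi> 0"
        unfolding \<phi>_def Complex_eq
        by (intro continuous_intros) (auto simp: complex_nonpos_Reals_iff)
      have "(\<lambda>n. inverse (real (Suc n)) * r) \<longlonglongrightarrow> 0 * r"
        by (intro tendsto_mult LIMSEQ_inverse_real_of_nat tendsto_const)
      then have "(\<lambda>n. \<phi> (inverse (real (Suc n)) * r)) \<longlonglongrightarrow> \<phi> 0"
        using isCont_tendsto_compose[OF c] by simp
      moreover have "\<phi> 0 = 1" by (simp add: \<phi>_def flip: one_complex.code)
      ultimately have "(\<lambda>n. \<phi> (inverse (real (Suc n)) * r)) \<longlonglongrightarrow> 1" by simp
      from tendsto_mult[OF this tendsto_const]
      show "(\<lambda>n. \<phi> (inverse (Suc n) * r) * of_real (exp (- (r\<^sup>2) / 2))) \<longlonglongrightarrow> of_real (exp (- (r\<^sup>2) / 2))"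
        by simp
    qed
    show "AE r in lborel. norm (\<phi> (inverse (Suc n) * r) * of_real (exp (- (r\<^sup>2) / 2))) \<le> exp (- (r\<^sup>2) / 2)" for n
      using \<phi>_le by (auto simp: norm_mult intro: mult_left_le_one_le)
  qed measurable
  then have "(LINT r|lborel. complex_of_real (exp (- (r\<^sup>2) / 2))) = 0"
    unfolding scaled0 by (simp add: LIMSEQ_const_iff)
  then show False
    unfolding integral_complex_of_real gv by simp
qed

section \<open>Riesz means at different points and of different orders\<close>

lemma frequency_finite_below:
  assumes "frequency lam"
  shows "finite {n. lam n < x}"
proof -
  have "eventually (\<lambda>n. x \<le> lam n) sequentially"
    using assms unfolding frequency_def filterlim_at_top by blast
  then obtain N where "\<And>n. N \<le> n \<Longrightarrow> x \<le> lam n"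
    by (auto simp: eventually_sequentially)
  then have "{n. lam n < x} \<subseteq> {..<N}"
    by (force simp: not_less[symmetric])
  then show ?thesis by (rule finite_subset) simp
qed

lemma frequency_nonneg: "frequency lam \<Longrightarrow> 0 \<le> lam n"
  by (simp add: frequency_def)

text \<open>With \<open>J\<close> denoting integration from 0, the power \<open>(1 + s J) ^ (N + 1)\<close> turns
  \<open>exp (- t * s) * (t - r)\<^sub>+ ^ N\<close> into \<open>exp (- r * s) * (t - r)\<^sub>+ ^ N\<close>. This transfers
  bounds for Riesz means at a point to the points on its right.\<close>

definition one_plus_J :: "complex \<Rightarrow> (real \<Rightarrow> complex) \<Rightarrow> real \<Rightarrow> complex" where
  "one_plus_J s v = (\<lambda>t. v t + s * integral {0..t} v)"

lemma integrable_on_integral: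
  fixes v :: "real \<Rightarrow> complex"
  assumes "v integrable_on {0..Y}"
  shows "(\<lambda>t. integral {0..t} v) integrable_on {0..Y}"
  by (intro integrable_continuous_real indefinite_integral_continuous_1 assms)

lemma one_plus_J_integrable:
  "v integrable_on {0..Y} \<Longrightarrow> one_plus_J s v integrable_on {0..Y}"
  unfolding one_plus_J_def
  by (intro integrable_add integrable_on_mult_right integrable_on_integral)

lemma one_plus_J_funpow_integrable:
  "v integrable_on {0..Y} \<Longrightarrow> (one_plus_J s ^^ j) v integrable_on {0..Y}"
  by (induction j) (auto intro: one_plus_J_integrable)

lemma one_plus_J_cong:
  "(\<And>t. t \<in> {0..Y} \<Longrightarrow> v t = v' t) \<Longrightarrow> t \<in> {0..Y} \<Longrightarrow> one_plus_J s v t = one_plus_J s v' t"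
  unfolding one_plus_J_def by (auto intro!: arg_cong2[where f = "(*)"] integral_cong)

lemma one_plus_J_funpow_sum:
  assumes "\<And>n. n \<in> F \<Longrightarrow> v n integrable_on {0..Y}" "finite F"
  shows "t \<in> {0..Y} \<Longrightarrow> (one_plus_J s ^^ j) (\<lambda>t. \<Sum>n\<in>F. b n * v n t) t = (\<Sum>n\<in>F. b n * (one_plus_J s ^^ j) (v n) t)"
proof (induction j arbitrary: t)
  case (Suc j)
  let ?w = "\<lambda>n. (one_plus_J s ^^ j) (v n)"
  have int: "?w n integrable_on {0..t}" if "n \<in> F" for n
    using one_plus_J_funpow_integrable[OF assms(1)[OF that]]
    by (rule integrable_subinterval_real) (use Suc.prems in auto)
  have "(one_plus_J s ^^ Suc j) (\<lambda>t. \<Sum>n\<in>F. b n * v n t) t = one_plus_J s (\<lambda>t. \<Sum>n\<in>F. b n * ?w n t) t"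
    unfolding funpow.simps o_apply by (rule one_plus_J_cong[of Y]) (use Suc in auto)
  also have "integral {0..t} (\<lambda>t. \<Sum>n\<in>F. b n * ?w n t) = (\<Sum>n\<in>F. b n * integral {0..t} (?w n))"
    using int assms(2) by (subst integral_sum) (auto intro: integrable_on_mult_right)
  then have "one_plus_J s (\<lambda>t. \<Sum>n\<in>F. b n * ?w n t) t = (\<Sum>n\<in>F. b n * one_plus_J s (?w n) t)"
    by (simp add: one_plus_J_def sum.distrib sum_distrib_left algebra_simps)
  finally show ?case by simp
qed auto

lemma one_plus_J_integral_commute:
  assumes "v integrable_on {0..Y}" "t \<in> {0..Y}"
  shows "one_plus_J s (\<lambda>t. c * integral {0..t} v) t = c * integral {0..t} (one_plus_J s v)"
proof -
  have v: "v integrable_on {0..t}"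
    using assms(1) by (rule integrable_subinterval_real) (use assms in auto)
  have "integral {0..t} (one_plus_J s v) = integral {0..t} v + s * integral {0..t} (\<lambda>t. integral {0..t} v)"
    unfolding one_plus_J_def using v integrable_on_integral[OF v]
    by (subst integral_add) (auto intro: integrable_on_mult_right)
  then show ?thesis by (simp add: one_plus_J_def algebra_simps)
qed

text \<open>The operators J and 1 + s J commute. In the induction on the exponent this lets the
  remaining factors act on the lower power under the integral.\<close>

lemma one_plus_J_funpow_integral_commute:
  assumes "v integrable_on {0..Y}"
  shows "t \<in> {0..Y} \<Longrightarrow> (one_plus_J s ^^ j) (\<lambda>t. c * integral {0..t} v) t = c * integral {0..t} ((one_plus_J s ^^ j) v)"
proof (induction j arbitrary: t)
  case (Suc j)
  have "(one_plus_J s ^^ Suc j) (\<lambda>t. c * integral {0..t} v) t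
      = one_plus_J s (\<lambda>t. c * integral {0..t} ((one_plus_J s ^^ j) v)) t"
    unfolding funpow.simps o_apply by (rule one_plus_J_cong[of Y]) (use Suc in auto)
  also have "\<dots> = c * integral {0..t} ((one_plus_J s ^^ Suc j) v)"
    using one_plus_J_integral_commute[OF one_plus_J_funpow_integrable[OF assms] Suc.prems] by simp
  finally show ?case .
qed auto

text \<open>The cut is at t <= r, so that the truncated power (t - r)^0 vanishes at t = r too, in
  agreement with the strict inequality \<open>lam n < x\<close> in
  \<open>riesz_mean\<close>.\<close>

definition after :: "real \<Rightarrow> (real \<Rightarrow> complex) \<Rightarrow> real \<Rightarrow> complex" where
  "after r v = (\<lambda>t. if t \<le> r then 0 else v t)"

lemma has_integral_after:
  assumes "\<And>t. (V has_vector_derivative v t) (at t)" "V r = 0" "0 \<le> r"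
  shows "(after r v has_integral after r V t) {0..t}"
proof (cases "t \<le> r")
  case True
  then have "(after r v has_integral 0) {0..t}"
    by (intro has_integral_is_0) (auto simp: after_def)
  then show ?thesis using True by (simp add: after_def)
next
  case False
  have "(v has_integral V t - V r) {r..t}"
    by (rule fundamental_theorem_of_calculus)
       (use False assms in \<open>auto intro: has_vector_derivative_at_within\<close>)
  then have "(after r v has_integral V t - V r) {r..t}"
    by (rule has_integral_spike_finite[of "{r}", rotated -1]) (auto simp: after_def)
  moreover have "(after r v has_integral 0) {0..r}"
    by (intro has_integral_is_0) (auto simp: after_def)
  ultimately have "(after r v has_integral 0 + (V t - V r)) {0..t}"
    by (intro has_integral_combine[of 0 r t]) (use assms False in auto)
  then show ?thesis using assms False by (simp add: after_def)
qed

text \<open>Let e_N be the truncated function exp(-t s) (t - r)^N. Integrating its derivative gives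
  e_(N+1) = (N + 1) J e_N - s J e_(N+1), hence (1 + s J) e_(N+1) = (N + 1) J e_N; the other factors
  commute with J and meet the case N. For N = 0 a single factor freezes exp(-t s) at t = r.\<close>

lemma one_plus_J_exp_power:
  assumes s: "s \<noteq> 0" and r: "0 \<le> r"
  shows "t \<in> {0..Y} \<Longrightarrow>
    (one_plus_J s ^^ Suc N) (after r (\<lambda>t. exp (- of_real t * s) * of_real ((t - r) ^ N))) t
      = after r (\<lambda>t. exp (- of_real r * s) * of_real ((t - r) ^ N)) t"
proof (induction N arbitrary: t)
  case 0
  have "(after r (\<lambda>t. exp (- of_real t * s)) has_integral
      after r (\<lambda>t. (exp (- of_real r * s) - exp (- of_real t * s)) / s) t) {0..t}"
  proof (rule has_integral_after)
    show "((\<lambda>t. (exp (- of_real r * s) - exp (- of_real t * s)) / s) has_vector_derivative exp (- of_real t * s)) (at t)" for t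
      using s by (auto intro!: derivative_eq_intros has_vector_derivative_real_field simp: field_simps)
  qed (use r in auto)
  then have "integral {0..t} (after r (\<lambda>t. exp (- of_real t * s))) = after r (\<lambda>t. (exp (- of_real r * s) - exp (- of_real t * s)) / s) t"
    by (rule integral_unique)
  then show ?case
    using s by (simp add: one_plus_J_def) (simp add: after_def)
next
  case (Suc N)
  define e where "e = (\<lambda>N. after r (\<lambda>t. exp (- of_real t * s) * of_real ((t - r) ^ N)))"
  have ve: "((\<lambda>t. exp (- of_real t * s) * of_real ((t - r) ^ M)) has_vector_derivative
      of_nat M * (exp (- of_real t * s) * of_real ((t - r) ^ (M - 1))) - s * (exp (- of_real t * s) * of_real ((t - r) ^ M))) (at t)" for M t
    unfolding of_real_power of_real_diff
    by (auto intro!: derivative_eq_intros has_vector_derivative_real_field simp: algebra_simps)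
  have cont: "e M integrable_on {0..t}" for M t
  proof -
    have "(\<lambda>t. exp (- of_real t * s) * of_real ((t - r) ^ M)) integrable_on {r..t}"
      by (intro integrable_continuous_real continuous_intros)
    then have "e M integrable_on {r..t}"
      unfolding e_def by (rule integrable_spike_finite[of "{r}", rotated -1]) (auto simp: after_def)
    moreover have "e M integrable_on {0..min r t}"
      by (rule integrable_spike_finite[of "{}", OF _ _ integrable_0]) (auto simp: e_def after_def)
    ultimately show ?thesis
      using r Henstock_Kurzweil_Integration.integrable_combine[where a = 0 and b = t and c = r and f = "e M"] by (cases "r \<le> t") (auto simp: min_def)
  qed
  have step: "one_plus_J s (e (Suc N)) t = of_nat (Suc N) * integral {0..t} (e N)" for t
  proof -
    have "(after r (\<lambda>t. of_nat (Suc N) * (exp (- of_real t * s) * of_real ((t - r) ^ (Suc N - 1))) - s * (exp (- of_real t * s) * of_real ((t - r) ^ Suc N)))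
        has_integral e (Suc N) t) {0..t}"
      unfolding e_def by (rule has_integral_after[OF ve]) (use r in auto)
    also have "after r (\<lambda>t. of_nat (Suc N) * (exp (- of_real t * s) * of_real ((t - r) ^ (Suc N - 1))) - s * (exp (- of_real t * s) * of_real ((t - r) ^ Suc N)))
        = (\<lambda>t. of_nat (Suc N) * e N t - s * e (Suc N) t)"
      by (auto simp: after_def e_def)
    finally have "e (Suc N) t = of_nat (Suc N) * integral {0..t} (e N) - s * integral {0..t} (e (Suc N))"
      using cont by (subst integral_unique[symmetric]) (auto simp: integral_diff integrable_on_mult_right)
    then show ?thesis by (simp add: one_plus_J_def)
  qed
  have "(one_plus_J s ^^ Suc (Suc N)) (e (Suc N)) t = (one_plus_J s ^^ Suc N) (one_plus_J s (e (Suc N))) t"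
    by (simp only: funpow_Suc_right o_apply)
  also have "\<dots> = (one_plus_J s ^^ Suc N) (\<lambda>t. of_nat (Suc N) * integral {0..t} (e N)) t"
    using step by presburger
  also have "\<dots> = of_nat (Suc N) * integral {0..t} ((one_plus_J s ^^ Suc N) (e N))"
    by (rule one_plus_J_funpow_integral_commute[OF cont Suc.prems])
  also have "integral {0..t} ((one_plus_J s ^^ Suc N) (e N))
      = integral {0..t} (after r (\<lambda>t. exp (- of_real r * s) * of_real ((t - r) ^ N)))"
    using Suc.prems unfolding e_def by (intro integral_cong Suc.IH) auto
  also have "\<dots> = after r (\<lambda>t. exp (- of_real r * s) * of_real ((t - r) ^ Suc N / of_nat (Suc N))) t"
  proof (rule integral_unique, rule has_integral_after)
    show "((\<lambda>t. exp (- of_real r * s) * of_real ((t - r) ^ Suc N / of_nat (Suc N)))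
        has_vector_derivative exp (- of_real r * s) * of_real ((t - r) ^ N)) (at t)" for t
      unfolding of_real_power of_real_diff of_real_divide
      by (auto intro!: derivative_eq_intros has_vector_derivative_real_field simp del: of_nat_Suc power_Suc)
  qed (use r in auto)
  also have "of_nat (Suc N) * \<dots> = after r (\<lambda>t. exp (- of_real r * s) * of_real ((t - r) ^ Suc N)) t"
    by (simp add: after_def del: of_nat_Suc)
  finally show ?case unfolding e_def .
qed

text \<open>The exponential decay keeps the first integral below 2 C, so the first factor costs 1 +
  |s| but no power of t; every further factor costs 1 + |s| and 1 + t. With N + 1 factors the growth
  is thus only (1 + t)^N, which division by y^N can absorb.\<close>

lemma one_plus_J_funpow_bound:
  assumes v: "v integrable_on {0..Y}" and C: "0 \<le> C"
    and bd: "\<And>t. t \<in> {0..Y} \<Longrightarrow> cmod (v t) \<le> C * exp (- t / 2)"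
  shows "t \<in> {0..Y} \<Longrightarrow> cmod ((one_plus_J s ^^ Suc j) v t) \<le> 2 * C * (1 + cmod s) ^ Suc j * (1 + t) ^ j"
proof (induction j arbitrary: t)
  case 0
  have h: "((\<lambda>t. C * exp (- t / 2)) has_integral (- 2 * C * exp (- t / 2)) - (- 2 * C * exp (- 0 / 2))) {0..t}"
    by (rule fundamental_theorem_of_calculus)
       (use 0 in \<open>auto intro!: derivative_eq_intros simp: has_real_derivative_iff_has_vector_derivative[symmetric]\<close>)
  have "cmod (integral {0..t} v) \<le> integral {0..t} (\<lambda>t. C * exp (- t / 2))"
  proof (rule integral_norm_bound_integral)
    show "v integrable_on {0..t}"
      using v by (rule integrable_subinterval_real) (use 0 in auto)
  qed (use h bd 0 in auto)
  also have "\<dots> = 2 * C * (1 - exp (- t / 2))"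
    using integral_unique[OF h] by (simp add: algebra_simps)
  also have "\<dots> \<le> 2 * C"
    using C by (simp add: mult_left_le)
  finally have i: "cmod (integral {0..t} v) \<le> 2 * C" .
  have "cmod (v t) \<le> C * exp (- t / 2)" by (rule bd) (use 0 in auto)
  also have "\<dots> \<le> C" using C 0 by (simp add: mult_left_le)
  finally have "cmod (v t) \<le> 2 * C" using C by simp
  then have "cmod (v t + s * integral {0..t} v) \<le> 2 * C + cmod s * (2 * C)"
    using i by (intro norm_triangle_mono) (auto simp: norm_mult intro: mult_left_mono)
  then show ?case by (simp add: one_plus_J_def algebra_simps)
next
  case (Suc j)
  let ?w = "(one_plus_J s ^^ Suc j) v" and ?A = "2 * C * (1 + cmod s) ^ Suc j"
  have A: "0 \<le> ?A" using C by simp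
  have w: "?w integrable_on {0..t}"
    using one_plus_J_funpow_integrable[OF v] by (rule integrable_subinterval_real) (use Suc.prems in auto)
  have "cmod (integral {0..t} ?w) \<le> integral {0..t} (\<lambda>_. ?A * (1 + t) ^ j)"
  proof (rule integral_norm_bound_integral[OF w])
    fix x assume x: "x \<in> {0..t}"
    have "cmod (?w x) \<le> ?A * (1 + x) ^ j"
      by (rule Suc.IH) (use Suc.prems x in auto)
    also have "\<dots> \<le> ?A * (1 + t) ^ j"
      using x by (intro mult_left_mono[OF _ A] power_mono) auto
    finally show "cmod (?w x) \<le> ?A * (1 + t) ^ j" .
  qed auto
  also have "\<dots> = t * (?A * (1 + t) ^ j)"
    using Suc.prems by simp
  finally have "cmod (?w t + s * integral {0..t} ?w) \<le> ?A * (1 + t) ^ j + cmod s * (t * (?A * (1 + t) ^ j))"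
    using Suc.IH[OF Suc.prems] by (intro norm_triangle_mono) (auto simp: norm_mult intro: mult_left_mono)
  also have "\<dots> = ?A * (1 + t) ^ j * (1 + cmod s * t)"
    by (simp add: algebra_simps)
  also have "\<dots> \<le> ?A * (1 + t) ^ j * ((1 + cmod s) * (1 + t))"
    using Suc.prems A by (intro mult_left_mono mult_nonneg_nonneg[OF A]) (auto simp: algebra_simps)
  also have "\<dots> = 2 * C * (1 + cmod s) ^ Suc (Suc j) * (1 + t) ^ Suc j"
    by (simp add: algebra_simps)
  finally have "cmod (one_plus_J s ?w t) \<le> 2 * C * (1 + cmod s) ^ Suc (Suc j) * (1 + t) ^ Suc j"
    unfolding one_plus_J_def .
  then show ?case by (simp only: funpow.simps o_apply)
qed

lemma riesz_mean_eq_sum_power: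
  assumes "0 < x"
  shows "riesz_mean lam a k x s * of_real (x powr k) = (\<Sum>n | lam n < x. a n * exp (- of_real (lam n) * s) * of_real ((x - lam n) powr k))"
  unfolding riesz_mean_def sum_distrib_right
proof (rule sum.cong)
  fix n assume n: "n \<in> {n. lam n < x}"
  have "(1 - lam n / x) powr k * x powr k = ((1 - lam n / x) * x) powr k"
    using n assms by (simp add: powr_mult)
  also have "(1 - lam n / x) * x = x - lam n"
    using assms by (simp add: field_simps)
  finally show "a n * exp (- of_real (lam n) * s) * of_real ((1 - lam n / x) powr k) * of_real (x powr k)
      = a n * exp (- of_real (lam n) * s) * of_real ((x - lam n) powr k)"
    by (simp flip: of_real_mult)
qed simp

text \<open>One term of the exponential series at t / 2. Half of the decay is kept, as
  \<open>one_plus_J_funpow_bound\<close> requires.\<close>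

lemma power_times_exp_le:
  fixes t :: real
  assumes "0 \<le> t"
  shows "t ^ N * exp (- t) \<le> 2 ^ N * fact N * exp (- t / 2)"
proof -
  have "(t / 2) ^ N / fact N \<le> exp (t / 2)"
  proof -
    have s: "(\<lambda>n. (t / 2) ^ n /\<^sub>R fact n) sums exp (t / 2)" by (rule exp_converges)
    have "(\<Sum>n\<in>{N}. (t / 2) ^ n /\<^sub>R fact n) \<le> exp (t / 2)"
      unfolding sums_unique[OF s] by (rule sum_le_suminf[OF sums_summable[OF s]]) (use assms in auto)
    then have "inverse (fact N) * (t / 2) ^ N \<le> exp (t / 2)" by simp
    then show ?thesis by (simp only: divide_inverse_commute)
  qed
  then have "(t / 2) ^ N \<le> exp (t / 2) * fact N"
    by (simp only: pos_divide_le_eq fact_gt_zero)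
  then have "2 ^ N * (t / 2) ^ N \<le> 2 ^ N * (exp (t / 2) * fact N)"
    by (rule mult_left_mono) simp
  also have "2 ^ N * (t / 2) ^ N = t ^ N"
    by (subst power_mult_distrib[symmetric]) simp
  finally have "t ^ N \<le> 2 ^ N * fact N * exp (t / 2)"
    by (simp only: mult_ac)
  then have "t ^ N * exp (- t) \<le> 2 ^ N * fact N * exp (t / 2) * exp (- t)"
    by (rule mult_right_mono) simp
  also have "\<dots> = 2 ^ N * fact N * exp (- t / 2)"
    by (simp flip: exp_add)
  finally show ?thesis .
qed

text \<open>Let v(t) be exp(-t s) t^N times the mean at s0 up to t. In each Dirichlet term the
  operator replaces exp(-t s) by exp(-lam n * s), which turns v(y) into y^N times the mean at s0 +
  s. The condition Re s >= 1 supplies the decay exp(-t).\<close>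

lemma riesz_mean_shift_bound:
  assumes lam: "frequency lam"
    and B: "\<And>y. 0 < y \<Longrightarrow> cmod (riesz_mean lam a (real N) y s0) \<le> B"
  obtains C where "\<And>y s. 1 \<le> y \<Longrightarrow> 1 \<le> Re s \<Longrightarrow>
    cmod (riesz_mean lam a (real N) y (s0 + s)) \<le> C * (1 + cmod s) ^ Suc N"
proof (rule that)
  define C where "C = B * (2 ^ N * fact N)"
  have B0: "0 \<le> B" by (rule order_trans[OF norm_ge_zero B[of 1]]) simp
  fix y :: real and s :: complex assume y: "1 \<le> y" and s: "1 \<le> Re s"
  define F where "F = {n. lam n < y}"
  define b where "b = (\<lambda>n. a n * exp (- of_real (lam n) * s0))"
  define v where "v = (\<lambda>n. after (lam n) (\<lambda>t. exp (- of_real t * s) * of_real ((t - lam n) ^ N)))"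
  have fin: "finite F" unfolding F_def by (rule frequency_finite_below[OF lam])
  have lam0: "0 \<le> lam n" for n by (rule frequency_nonneg[OF lam])
  have v_int: "v n integrable_on {0..y}" if "n \<in> F" for n
  proof (rule Henstock_Kurzweil_Integration.integrable_combine[where a = 0 and b = y and c = "lam n"])
    have "(\<lambda>t. exp (- of_real t * s) * of_real ((t - lam n) ^ N)) integrable_on {lam n..y}"
      by (intro integrable_continuous_real continuous_intros)
    then show "v n integrable_on {lam n..y}"
      unfolding v_def by (rule integrable_spike_finite[of "{lam n}", rotated -1]) (auto simp: after_def)
    show "v n integrable_on {0..lam n}"
      by (rule integrable_spike_finite[of "{}", OF _ _ integrable_0]) (auto simp: v_def after_def)
  qed (use that lam0 in \<open>auto simp: F_def\<close>)
  have riesz_sum: "riesz_mean lam a (real N) t s' * of_real (t ^ N)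
      = (\<Sum>n\<in>F. a n * exp (- of_real (lam n) * s') * (if t \<le> lam n then 0 else of_real ((t - lam n) ^ N)))"
    if t: "0 < t" "t \<le> y" for t s'
  proof -
    have "riesz_mean lam a (real N) t s' * of_real (t ^ N)
        = (\<Sum>n | lam n < t. a n * exp (- of_real (lam n) * s') * of_real ((t - lam n) powr real N))"
      using riesz_mean_eq_sum_power[OF t(1), of lam a "real N" s'] t by (simp add: powr_realpow)
    also have "\<dots> = (\<Sum>n\<in>F. a n * exp (- of_real (lam n) * s') * (if t \<le> lam n then 0 else of_real ((t - lam n) ^ N)))"
      using t by (intro sum.mono_neutral_cong_left fin) (auto simp: F_def powr_realpow)
    finally show ?thesis .
  qed
  let ?v = "\<lambda>t. \<Sum>n\<in>F. b n * v n t"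
  have bound: "cmod (?v t) \<le> C * exp (- t / 2)" if t: "t \<in> {0..y}" for t
  proof (cases "t = 0")
    case True
    then have "?v t = 0" using lam0 by (simp add: v_def after_def)
    then show ?thesis using B0 by (simp add: C_def)
  next
    case False
    have "?v t = exp (- of_real t * s) * (\<Sum>n\<in>F. a n * exp (- of_real (lam n) * s0) * (if t \<le> lam n then 0 else of_real ((t - lam n) ^ N)))"
      unfolding sum_distrib_left by (intro sum.cong) (auto simp: b_def v_def after_def mult_ac)
    also have "\<dots> = exp (- of_real t * s) * (riesz_mean lam a (real N) t s0 * of_real (t ^ N))"
      using False t by (subst riesz_sum) auto
    finally have "cmod (?v t) = exp (- t * Re s) * (cmod (riesz_mean lam a (real N) t s0) * t ^ N)"
      using t by (simp add: norm_mult norm_power)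
    also have "\<dots> \<le> exp (- t) * (B * t ^ N)"
      using t s False B[of t] B0 mult_left_mono[OF s, of t] by (intro mult_mono mult_right_mono) auto
    also have "\<dots> = B * (t ^ N * exp (- t))" by simp
    also have "\<dots> \<le> B * (2 ^ N * fact N * exp (- t / 2))"
      using t by (intro mult_left_mono[OF power_times_exp_le] B0) auto
    finally show ?thesis by (simp add: C_def)
  qed
  have "(one_plus_J s ^^ Suc N) ?v y = (\<Sum>n\<in>F. b n * (one_plus_J s ^^ Suc N) (v n) y)"
    by (rule one_plus_J_funpow_sum[OF v_int fin]) (use y in auto)
  also have "\<dots> = (\<Sum>n\<in>F. b n * after (lam n) (\<lambda>t. exp (- of_real (lam n) * s) * of_real ((t - lam n) ^ N)) y)"
    unfolding v_def using s y by (intro sum.cong refl arg_cong2[where f = "(*)"] one_plus_J_exp_power[where Y = y] lam0) auto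
  also have "\<dots> = riesz_mean lam a (real N) y (s0 + s) * of_real (y ^ N)"
    using y by (subst riesz_sum) (auto intro!: sum.cong simp: b_def after_def distrib_left exp_add exp_diff exp_minus field_simps)
  finally have e: "(one_plus_J s ^^ Suc N) ?v y = riesz_mean lam a (real N) y (s0 + s) * of_real (y ^ N)" .
  have "cmod (riesz_mean lam a (real N) y (s0 + s)) * y ^ N \<le> 2 * C * (1 + cmod s) ^ Suc N * (1 + y) ^ N"
  proof -
    have "cmod ((one_plus_J s ^^ Suc N) ?v y) \<le> 2 * C * (1 + cmod s) ^ Suc N * (1 + y) ^ N"
    proof (rule one_plus_J_funpow_bound)
      show "?v integrable_on {0..y}"
        using v_int fin by (intro integrable_sum integrable_on_mult_right) auto
    qed (use bound B0 y in \<open>auto simp: C_def\<close>)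
    then show ?thesis unfolding e using y by (simp add: norm_mult norm_power)
  qed
  \<comment> \<open>For y >= 1 the factor (1 + y)^N is at most (2 y)^N, and y^N then
    cancels.\<close>
  also have "\<dots> \<le> 2 * C * (1 + cmod s) ^ Suc N * (2 * y) ^ N"
    using y B0 by (intro mult_left_mono power_mono) (auto simp: C_def)
  also have "\<dots> = (2 * C * 2 ^ N * (1 + cmod s) ^ Suc N) * y ^ N"
    by (simp add: power_mult_distrib)
  finally show "cmod (riesz_mean lam a (real N) y (s0 + s)) \<le> (2 * C * 2 ^ N) * (1 + cmod s) ^ Suc N"
    using y by (simp del: power_Suc)
qed

section \<open>Beta averages: passing to Riesz means of higher order\<close>

definition beta_density :: "real \<Rightarrow> real \<Rightarrow> real \<Rightarrow> real \<Rightarrow> real" where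
  "beta_density p m r t = indicator {r<..<1} t * ((1 - t) powr p * (t - r) powr m)"

lemma beta_density_measurable [measurable]: "beta_density p m r \<in> borel_measurable borel"
  unfolding beta_density_def by measurable

lemma beta_density_bounds:
  assumes "0 \<le> p" "0 \<le> m" "0 \<le> r"
  shows "0 \<le> beta_density p m r t" "beta_density p m r t \<le> indicator {0..1} t"
proof -
  have "(1 - t) powr p * (t - r) powr m \<le> 1 * 1" if "r < t" "t < 1"
    using that assms by (intro mult_mono powr_le1) auto
  then show "beta_density p m r t \<le> indicator {0..1} t"
    using assms by (auto simp: beta_density_def indicator_def)
qed (auto simp: beta_density_def)

lemma beta_density_integrable:
  assumes "0 \<le> p" "0 \<le> m" "0 \<le> r"
  shows "integrable lborel (beta_density p m r)"
proof (rule Bochner_Integration.integrable_bound)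
  show "integrable lborel (indicator {0..1::real} :: real \<Rightarrow> real)" by simp
  show "AE t in lborel. norm (beta_density p m r t) \<le> norm (indicator {0..1} t :: real)"
    using beta_density_bounds[OF assms] by (intro AE_I2) simp
qed simp

text \<open>The substitution maps (0, 1) onto (r, 1) and pulls 1 - r out of both powers; the last 1
  in the exponent is its Jacobian. With r = lam n / y this is the weight of a Riesz mean of order p
  + m + 1.\<close>

lemma integral_beta_density_scale:
  assumes "0 \<le> r" "r < 1"
  shows "(LINT t|lborel. beta_density p m r t) = (1 - r) powr (p + m + 1) * (LINT t|lborel. beta_density p m 0 t)"
proof -
  have "(LINT t|lborel. beta_density p m r t) = \<bar>1 - r\<bar> *\<^sub>R (LINT t|lborel. beta_density p m r (r + (1 - r) * t))"
    by (rule lborel_integral_real_affine) (use assms in auto)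
  also have "(\<lambda>t. beta_density p m r (r + (1 - r) * t)) = (\<lambda>t. (1 - r) powr (p + m) * beta_density p m 0 t)"
  proof
    fix t
    have "r + (1 - r) * t < 1 \<longleftrightarrow> (1 - r) * (1 - t) > 0" by (simp add: algebra_simps)
    also have "\<dots> \<longleftrightarrow> t < 1" using assms by (simp add: zero_less_mult_iff)
    finally have 1: "r + (1 - r) * t < 1 \<longleftrightarrow> t < 1" .
    have 4: "0 < (1 - r) * t \<longleftrightarrow> 0 < t"
      using assms by (metis diff_gt_0_iff_gt mult_pos_pos zero_less_mult_pos)
    have 3: "1 - (r + (1 - r) * t) = (1 - r) * (1 - t)" "r + (1 - r) * t - r = (1 - r) * t"
      by (simp_all add: algebra_simps)
    show "beta_density p m r (r + (1 - r) * t) = (1 - r) powr (p + m) * beta_density p m 0 t"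
      using assms unfolding beta_density_def 3
      by (auto simp: indicator_def 1 4 powr_mult powr_add)
  qed
  also have "\<bar>1 - r\<bar> *\<^sub>R (LINT t|lborel. (1 - r) powr (p + m) * beta_density p m 0 t)
      = ((1 - r) powr (p + m) * (1 - r) powr 1) * (LINT t|lborel. beta_density p m 0 t)"
    using assms by simp
  also have "(1 - r) powr (p + m) * (1 - r) powr 1 = (1 - r) powr (p + m + 1)"
    by (rule powr_add[symmetric])
  finally show ?thesis .
qed

lemma integral_beta_density_pos:
  assumes "0 \<le> p" "0 \<le> m"
  shows "0 < (LINT t|lborel. beta_density p m 0 t)"
proof -
  let ?c = "(1 / 4) powr p * (1 / 4) powr m :: real"
  have "0 < ?c * (1 / 2)" by simp
  also have "\<dots> = (LINT t|lborel. ?c * indicator {1/4..3/4::real} t)" by simp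
  also have "\<dots> \<le> (LINT t|lborel. beta_density p m 0 t)"
  proof (rule integral_mono)
    show "integrable lborel (\<lambda>t. ?c * indicator {1/4..3/4::real} t)"
      by (rule integrable_mult_right, rule integrable_real_indicator) (auto simp: less_top[symmetric])
    show "integrable lborel (beta_density p m 0)" using assms by (intro beta_density_integrable) auto
    show "?c * indicator {1/4..3/4} t \<le> beta_density p m 0 t" for t :: real
    proof (cases "t \<in> {1/4..3/4}")
      case True
      then have "?c \<le> (1 - t) powr p * (t - 0) powr m"
        using assms by (intro mult_mono powr_mono2) auto
      then show ?thesis using True by (simp add: beta_density_def)
    qed (use beta_density_bounds[OF assms] in auto)
  qed
  finally show ?thesis .
qed

text \<open>Termwise this is t^m (1 - r / t)^m = (t - r)^m with r = lam n / y. It holds for all real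
  y and t, since both sides vanish when y <= 0 or t lies outside (0, 1); it therefore also shows
  that the left side is measurable in t.\<close>

lemma beta_density_times_riesz_mean:
  assumes lam: "frequency lam"
  shows "of_real (beta_density p m 0 t) * riesz_mean lam a m (y * t) s
    = (\<Sum>n | lam n < y. a n * exp (- of_real (lam n) * s) * of_real (beta_density p m (lam n / y) t))"
proof -
  let ?F = "{n. lam n < y}"
  let ?c = "\<lambda>n. a n * exp (- of_real (lam n) * s)"
  have fin: "finite ?F" by (rule frequency_finite_below[OF lam])
  have lam0: "0 \<le> lam n" for n by (rule frequency_nonneg[OF lam])
  have "of_real (beta_density p m 0 t) * riesz_mean lam a m (y * t) s
      = (\<Sum>n\<in>?F. ?c n * of_real (beta_density p m (lam n / y) t))" if y: "0 < y"
  proof (cases "0 < t \<and> t < 1")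
    case False
    then have "beta_density p m (lam n / y) t = 0" for n
      using divide_nonneg_pos[OF lam0[of n] y] by (auto simp: beta_density_def indicator_def)
    moreover have "beta_density p m 0 t = 0"
      using False by (auto simp: beta_density_def indicator_def)
    ultimately show ?thesis by simp
  next
    case True
    then have yt: "0 < y * t" "y * t < y" using y by auto
    have "of_real (beta_density p m 0 t) * riesz_mean lam a m (y * t) s
        = (\<Sum>n | lam n < y * t. ?c n * of_real (beta_density p m 0 t * (1 - lam n / (y * t)) powr m))"
      unfolding riesz_mean_def sum_distrib_left by (intro sum.cong) (auto simp: mult_ac)
    also have "\<dots> = (\<Sum>n\<in>?F. ?c n * of_real (beta_density p m (lam n / y) t))"
    proof (rule sum.mono_neutral_cong_left[OF fin])
      show "\<forall>n\<in>?F - {n. lam n < y * t}. ?c n * of_real (beta_density p m (lam n / y) t) = 0"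
        using y by (auto simp: beta_density_def indicator_def field_simps)
      fix n assume n: "n \<in> {n. lam n < y * t}"
      have "t powr m * (1 - lam n / (y * t)) powr m = (t * (1 - lam n / (y * t))) powr m"
        using True n yt by (simp add: powr_mult)
      also have "t * (1 - lam n / (y * t)) = t - lam n / y"
        using True y by (simp add: field_simps)
      finally have "t powr m * (1 - lam n / (y * t)) powr m = (t - lam n / y) powr m" .
      moreover have "lam n / y < t" using n y by (simp add: divide_less_eq mult.commute)
      ultimately show "?c n * of_real (beta_density p m 0 t * (1 - lam n / (y * t)) powr m)
          = ?c n * of_real (beta_density p m (lam n / y) t)"
        using True by (simp add: beta_density_def mult.assoc)
    qed (use yt in auto)
    finally show ?thesis .
  qed
  moreover have "of_real (beta_density p m 0 t) * riesz_mean lam a m (y * t) s = 0 \<and> ?F = {}" if "y \<le> 0"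
  proof (cases "0 < t")
    case True
    then have "y * t \<le> 0" using that by (simp add: mult_nonpos_nonneg)
    then have "{n. lam n < y * t} = {}" "?F = {}" using that lam0 by (auto simp: not_less intro: order_trans)
    then show ?thesis by (simp add: riesz_mean_def)
  next
    case False
    then show ?thesis using that lam0 by (auto simp: beta_density_def indicator_def not_less intro: order_trans)
  qed
  ultimately show ?thesis
    by (cases "0 < y") auto
qed

lemma riesz_mean_average:
  assumes lam: "frequency lam" and y: "0 < y" and pm: "0 \<le> p" "0 \<le> m"
  shows "(LINT t|lborel. of_real (beta_density p m 0 t) * riesz_mean lam a m (y * t) s)
      = of_real (LINT t|lborel. beta_density p m 0 t) * riesz_mean lam a (p + m + 1) y s"
proof -
  let ?F = "{n. lam n < y}"
  let ?c = "\<lambda>n. a n * exp (- of_real (lam n) * s)"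
  have fin: "finite ?F" by (rule frequency_finite_below[OF lam])
  have lam0: "0 \<le> lam n" for n by (rule frequency_nonneg[OF lam])
  have "(LINT t|lborel. of_real (beta_density p m 0 t) * riesz_mean lam a m (y * t) s)
      = (LINT t|lborel. (\<Sum>n\<in>?F. ?c n * of_real (beta_density p m (lam n / y) t)))"
    by (simp only: beta_density_times_riesz_mean[OF lam])
  also have "\<dots> = (\<Sum>n\<in>?F. ?c n * of_real (LINT t|lborel. beta_density p m (lam n / y) t))"
    using pm lam0 y beta_density_integrable by (subst Bochner_Integration.integral_sum) auto
  also have "\<dots> = (\<Sum>n\<in>?F. ?c n * of_real ((1 - lam n / y) powr (p + m + 1) * (LINT t|lborel. beta_density p m 0 t)))"
    using y lam0 by (intro sum.cong refl arg_cong2[where f = "(*)"] arg_cong[where f = of_real] integral_beta_density_scale) auto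
  also have "\<dots> = of_real (LINT t|lborel. beta_density p m 0 t) * riesz_mean lam a (p + m + 1) y s"
    unfolding riesz_mean_def sum_distrib_left by (intro sum.cong) (auto simp: mult_ac)
  finally show ?thesis .
qed

text \<open>Beyond some X the limit controls the means; below it only the finitely many terms with
  lam n < X occur, each with weight at most 1. All x > 0 are covered because averages over (0, y)
  involve small arguments as well.\<close>

lemma riesz_mean_bounded_if_convergent:
  assumes lam: "frequency lam" and m: "0 \<le> m"
    and conv: "((\<lambda>x. riesz_mean lam a m x s) \<longlongrightarrow> L) at_top"
  obtains B where "\<And>x. 0 < x \<Longrightarrow> cmod (riesz_mean lam a m x s) \<le> B"
proof -
  have "eventually (\<lambda>x. dist (riesz_mean lam a m x s) L < 1) at_top"
    using conv by (rule tendstoD) simp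
  then obtain X where X: "\<And>x. X \<le> x \<Longrightarrow> dist (riesz_mean lam a m x s) L < 1"
    by (auto simp: eventually_at_top_linorder)
  define B1 where "B1 = (\<Sum>n | lam n < X. cmod (a n * exp (- of_real (lam n) * s)))"
  have B1: "0 \<le> B1" unfolding B1_def by (rule sum_nonneg) simp
  show ?thesis
  proof (rule that)
    fix x :: real assume x: "0 < x"
    show "cmod (riesz_mean lam a m x s) \<le> B1 + (cmod L + 1)"
    proof (cases "X \<le> x")
      case True
      then have "cmod (riesz_mean lam a m x s - L) < 1" using X by (simp add: dist_norm)
      moreover have "cmod (riesz_mean lam a m x s) \<le> cmod L + cmod (riesz_mean lam a m x s - L)"
        by (rule norm_triangle_sub)
      ultimately show ?thesis using B1 by linarith
    next
      case False
      have "cmod (riesz_mean lam a m x s) \<le> (\<Sum>n | lam n < x. cmod (a n * exp (- of_real (lam n) * s)))"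
        unfolding riesz_mean_def
      proof (rule sum_norm_le)
        fix n assume "n \<in> {n. lam n < x}"
        then have "(1 - lam n / x) powr m \<le> 1"
          using x m frequency_nonneg[OF lam, of n] by (intro powr_le1) auto
        then show "cmod (a n * exp (- of_real (lam n) * s) * of_real ((1 - lam n / x) powr m))
            \<le> cmod (a n * exp (- of_real (lam n) * s))"
          by (simp add: norm_mult mult_left_le)
      qed
      also have "\<dots> \<le> B1"
        unfolding B1_def by (rule sum_mono2) (use False frequency_finite_below[OF lam] in auto)
      finally show ?thesis by (simp add: add_increasing2)
    qed
  qed
qed

text \<open>By \<open>riesz_mean_average\<close> the mean of order p + m + 1 at y is a weighted
  average of the means of order m at y * t with 0 < t < 1. For fixed t the point y * t tends to
  infinity, and the bound for all x > 0 dominates.\<close>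

lemma riesz_mean_raise_order:
  assumes lam: "frequency lam" and pm: "0 \<le> p" "0 \<le> m"
    and conv: "((\<lambda>x. riesz_mean lam a m x s) \<longlongrightarrow> L) at_top"
  shows "((\<lambda>x. riesz_mean lam a (p + m + 1) x s) \<longlongrightarrow> L) at_top"
proof -
  obtain B where B: "\<And>x. 0 < x \<Longrightarrow> cmod (riesz_mean lam a m x s) \<le> B"
    using riesz_mean_bounded_if_convergent[OF lam pm(2) conv] by blast
  let ?b = "beta_density p m 0"
  define c where "c = (LINT t|lborel. ?b t)"
  have c: "0 < c" unfolding c_def by (rule integral_beta_density_pos[OF pm])
  have b_int: "integrable lborel ?b" by (rule beta_density_integrable[OF pm]) simp
  have b0: "0 \<le> ?b t" for t by (rule beta_density_bounds(1)[OF pm]) simp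
  have "((\<lambda>y. LINT t|lborel. of_real (?b t) * riesz_mean lam a m (y * t) s) \<longlongrightarrow> (LINT t|lborel. of_real (?b t) * L)) at_top"
  proof (rule integral_dominated_convergence_at_top)
    show "(\<lambda>t. of_real (?b t) * L) \<in> borel_measurable lborel" by simp
    show "(\<lambda>t. of_real (?b t) * riesz_mean lam a m (y * t) s) \<in> borel_measurable lborel" for y
      unfolding beta_density_times_riesz_mean[OF lam] by simp
    show "integrable lborel (\<lambda>t. ?b t * B)" using b_int by simp
    show "AE t in lborel. ((\<lambda>y. of_real (?b t) * riesz_mean lam a m (y * t) s) \<longlongrightarrow> of_real (?b t) * L) at_top"
    proof (intro AE_I2)
      fix t :: real
      show "((\<lambda>y. of_real (?b t) * riesz_mean lam a m (y * t) s) \<longlongrightarrow> of_real (?b t) * L) at_top"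
      proof (cases "0 < t")
        case True
        then have "filterlim (\<lambda>y. y * t) at_top at_top"
          by (intro filterlim_at_top_mult_tendsto_pos[OF tendsto_const _ filterlim_ident])
        then show ?thesis
          by (intro tendsto_mult tendsto_const filterlim_compose[OF conv])
      qed (simp add: beta_density_def)
    qed
    show "\<forall>\<^sub>F y in at_top. AE t in lborel. norm (of_real (?b t) * riesz_mean lam a m (y * t) s) \<le> ?b t * B"
      using eventually_gt_at_top[of 0]
    proof eventually_elim
      case (elim y)
      show ?case
      proof (intro AE_I2)
        fix t :: real
        show "norm (of_real (?b t) * riesz_mean lam a m (y * t) s) \<le> ?b t * B"
        proof (cases "0 < t")
          case True
          then show ?thesis
            using elim b0[of t] B[of "y * t"] by (auto simp: norm_mult intro: mult_left_mono)
        qed (simp add: beta_density_def)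
      qed
    qed
  qed
  moreover have "\<forall>\<^sub>F y in at_top. (LINT t|lborel. of_real (?b t) * riesz_mean lam a m (y * t) s)
      = of_real c * riesz_mean lam a (p + m + 1) y s"
    using eventually_gt_at_top[of 0]
    by eventually_elim (use riesz_mean_average[OF lam _ pm] in \<open>auto simp: c_def\<close>)
  moreover have "(LINT t|lborel. of_real (?b t) * L) = of_real c * L"
    by (simp add: c_def)
  ultimately have "((\<lambda>y. of_real c * riesz_mean lam a (p + m + 1) y s) \<longlongrightarrow> of_real c * L) at_top"
    using tendsto_cong by fastforce
  from tendsto_mult[OF tendsto_const[of "inverse (of_real c)"] this] c show ?thesis
    by (simp flip: mult.assoc)
qed

section \<open>Perron's formula\<close>

lemma riesz_germ_integer_order:
  assumes lam: "frequency lam" and g: "riesz_germ lam a f"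
  obtains N :: nat and \<sigma> :: real where "0 \<le> \<sigma>"
    "\<And>s. \<sigma> < Re s \<Longrightarrow> ((\<lambda>x. riesz_mean lam a (real N) x s) \<longlongrightarrow> f s) at_top"
proof -
  obtain m \<sigma> where m: "0 \<le> m" and \<sigma>: "0 \<le> \<sigma>"
    and conv: "\<And>s. s \<in> right_halfplane \<sigma> \<Longrightarrow> ((\<lambda>x. riesz_mean lam a m x s) \<longlongrightarrow> f s) at_top"
    using g unfolding riesz_germ_def by blast
  \<comment> \<open>\<open>riesz_mean_raise_order\<close> raises the order by p + 1 with p >= 0, so
    N has to be at least m + 1.\<close>
  obtain N :: nat where N: "m + 1 \<le> real N" using real_arch_simple by blast
  show ?thesis
  proof (rule that[OF \<sigma>])
    fix s assume "\<sigma> < Re s"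
    then have "((\<lambda>x. riesz_mean lam a (real N - m - 1 + m + 1) x s) \<longlongrightarrow> f s) at_top"
      using N m by (intro riesz_mean_raise_order[OF lam] conv) (auto simp: right_halfplane_def)
    then show "((\<lambda>x. riesz_mean lam a (real N) x s) \<longlongrightarrow> f s) at_top" by simp
  qed
qed

definition perron_integral :: "(complex \<Rightarrow> complex) \<Rightarrow> complex \<Rightarrow> real \<Rightarrow> real \<Rightarrow> real \<Rightarrow> complex" where
  "perron_integral f w k c x =
     (LINT t|lborel. f (w + Complex c t) * (exp (of_real x * Complex c t) * Complex c t powr of_real (- k - 1)))"

text \<open>For x > 0 this is x powr k times the Riesz mean. Without the denominators the derivative
  in x simply lowers the order, up to a factor.\<close>

definition riesz_sum :: "(nat \<Rightarrow> real) \<Rightarrow> (nat \<Rightarrow> complex) \<Rightarrow> real \<Rightarrow> real \<Rightarrow> complex \<Rightarrow> complex" where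
  "riesz_sum lam a k x w = (\<Sum>n | lam n < x. a n * exp (- of_real (lam n) * w) * of_real ((x - lam n) powr k))"

lemma perron_integral_dirichlet_polynomial:
  assumes "finite F" "0 < k" "0 < c"
  shows "perron_integral (\<lambda>s. \<Sum>n\<in>F. b n * exp (- of_real (lam n) * s)) w k c x
    = perron_kernel k 1 1 * (\<Sum>n\<in>F. b n * exp (- of_real (lam n) * w) * of_real (max 0 (x - lam n) powr k))"
proof -
  let ?E = "\<lambda>n t. exp (of_real (x - lam n) * Complex c t) * Complex c t powr of_real (- k - 1)"
  have "perron_integral (\<lambda>s. \<Sum>n\<in>F. b n * exp (- of_real (lam n) * s)) w k c x
      = (LINT t|lborel. (\<Sum>n\<in>F. b n * exp (- of_real (lam n) * w) * ?E n t))"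
    unfolding perron_integral_def sum_distrib_right
  proof (intro Bochner_Integration.integral_cong sum.cong refl)
    fix n t
    have "exp (- of_real (lam n) * (w + Complex c t)) * exp (of_real x * Complex c t)
        = exp (- of_real (lam n) * w) * exp (of_real (x - lam n) * Complex c t)"
      unfolding exp_add[symmetric] by (simp add: algebra_simps)
    then show "b n * exp (- of_real (lam n) * (w + Complex c t)) * (exp (of_real x * Complex c t) * Complex c t powr of_real (- k - 1))
        = b n * exp (- of_real (lam n) * w) * ?E n t"
      by (simp add: mult.assoc)
  qed
  also have "\<dots> = (\<Sum>n\<in>F. b n * exp (- of_real (lam n) * w) * perron_kernel k c (x - lam n))"
    unfolding perron_kernel_def using perron_kernel_integrable[OF assms(2,3), of "x - lam n" for n]
    by (subst Bochner_Integration.integral_sum) auto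
  also have "\<dots> = (\<Sum>n\<in>F. b n * exp (- of_real (lam n) * w) * (of_real (max 0 (x - lam n) powr k) * perron_kernel k 1 1))"
    using perron_kernel_eq[OF assms(2,3)] by simp
  finally show ?thesis
    by (simp add: sum_distrib_left mult_ac)
qed

text \<open>The means of order N are Dirichlet polynomials; they replace f, and their cut-off y
  tends to infinity. Their growth |z|^(N+1) against |z|^(-k-1) leaves |z|^(N-k), integrable since k
  > N + 1.\<close>

lemma perron_formula_high_order:
  assumes lam: "frequency lam" and \<sigma>: "0 \<le> \<sigma>"
    and conv: "\<And>s. \<sigma> < Re s \<Longrightarrow> ((\<lambda>x. riesz_mean lam a (real N) x s) \<longlongrightarrow> f s) at_top"
    and hol: "f holomorphic_on right_halfplane 0"
    and k: "real N + 1 < k" and w: "0 < Re w" and c: "\<sigma> + 2 \<le> c" and x: "0 < x"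
  shows "perron_integral f w k c x = perron_kernel k 1 1 * riesz_sum lam a k x w"
proof -
  \<comment> \<open>Convergence is given right of \<sigma>, so the means are bounded at \<sigma> +
    1; with c >= \<sigma> + 2 the real part of w + z exceeds that of s0 by at least 1.\<close>
  define s0 where "s0 = complex_of_real (\<sigma> + 1)"
  have c0: "0 < c" "2 \<le> c" using \<sigma> c by auto
  obtain B where B: "\<And>y. 0 < y \<Longrightarrow> cmod (riesz_mean lam a (real N) y s0) \<le> B"
    using riesz_mean_bounded_if_convergent[OF lam _ conv[of s0]] by (auto simp: s0_def)
  obtain C where C: "\<And>y s. 1 \<le> y \<Longrightarrow> 1 \<le> Re s \<Longrightarrow>
      cmod (riesz_mean lam a (real N) y (s0 + s)) \<le> C * (1 + cmod s) ^ Suc N"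
    using riesz_mean_shift_bound[OF lam B] by blast
  have C0: "0 \<le> C"
  proof -
    have "0 \<le> C * (1 + cmod 1) ^ Suc N"
      by (rule order_trans[OF norm_ge_zero C[of 1 1]]) auto
    then show ?thesis
      using mult_neg_pos[of C "(1 + cmod 1) ^ Suc N"] zero_less_power[of "1 + cmod 1" "Suc N"] by force
  qed
  define K where "K = (1 + cmod w + cmod s0)"
  let ?R = "\<lambda>y s. riesz_mean lam a (real N) y s"
  let ?E = "\<lambda>t. exp (of_real x * Complex c t) * Complex c t powr of_real (- k - 1)"
  have R_bd: "cmod (?R y (w + Complex c t)) \<le> C * (2 * K) ^ Suc N * cmod (Complex c t) powr (real N + 1)"
    if y: "1 \<le> y" for y t
  proof -
    let ?z = "Complex c t"
    have z: "1 \<le> cmod ?z" using abs_Re_le_cmod[of ?z] c0 by simp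
    have "cmod (?R y (s0 + (w + ?z - s0))) \<le> C * (1 + cmod (w + ?z - s0)) ^ Suc N"
      by (rule C[OF y]) (use c w in \<open>simp add: s0_def\<close>)
    also have "\<dots> \<le> C * (2 * K * cmod ?z) ^ Suc N"
    proof (intro mult_left_mono power_mono C0)
      have "1 + cmod (w + ?z - s0) \<le> K + cmod ?z"
        using norm_triangle_ineq4[of "w + ?z" s0] norm_triangle_ineq[of w ?z] unfolding K_def by linarith
      moreover have "K \<le> K * cmod ?z" using mult_left_mono[OF z, of K] by (simp add: K_def)
      moreover have "cmod ?z \<le> K * cmod ?z"
        using mult_right_mono[of 1 K "cmod ?z"] by (simp add: K_def)
      moreover have "2 * K * cmod ?z = K * cmod ?z + K * cmod ?z" by simp
      ultimately show "1 + cmod (w + ?z - s0) \<le> 2 * K * cmod ?z" by linarith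
    qed simp
    also have "\<dots> = C * (2 * K) ^ Suc N * cmod ?z ^ Suc N" by (simp add: power_mult_distrib)
    also have "cmod ?z ^ Suc N = cmod ?z powr (real N + 1)"
      using z by (subst powr_realpow[symmetric]) (auto simp: add.commute)
    finally show ?thesis by simp
  qed
  have "((\<lambda>y. perron_integral (?R y) w k c x) \<longlongrightarrow> perron_integral f w k c x) at_top"
    unfolding perron_integral_def
  proof (rule integral_dominated_convergence_at_top)
    let ?W = "\<lambda>t. C * (2 * K) ^ Suc N * exp (x * c) * cmod (Complex c t) powr - (k - real N)"
    show "integrable lborel ?W"
      using integrable_cmod_line_powr[of "k - real N" c] k c0 by simp
    have E_meas: "?E \<in> borel_measurable lborel"
      using perron_kernel_integrable[of k c x] k c0 by auto
    have "(\<lambda>z. f (w + z)) holomorphic_on {z. 0 < Re z}"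
      by (rule holomorphic_on_compose_gen[OF _ hol, unfolded o_def])
         (use w in \<open>auto intro!: holomorphic_intros simp: right_halfplane_def\<close>)
    then show "(\<lambda>t. f (w + Complex c t) * ?E t) \<in> borel_measurable lborel"
      using holomorphic_line_measurable[of "\<lambda>z. f (w + z)" c] c0 E_meas by simp
    show "(\<lambda>t. ?R y (w + Complex c t) * ?E t) \<in> borel_measurable lborel" for y
      unfolding riesz_mean_def using E_meas by simp
    show "AE t in lborel. ((\<lambda>y. ?R y (w + Complex c t) * ?E t) \<longlongrightarrow> f (w + Complex c t) * ?E t) at_top"
      by (intro AE_I2 tendsto_mult tendsto_const conv) (use c w in auto)
    show "\<forall>\<^sub>F y in at_top. AE t in lborel. cmod (?R y (w + Complex c t) * ?E t) \<le> ?W t"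
      using eventually_ge_at_top[of 1]
    proof eventually_elim
      case (elim y)
      show ?case
      proof (intro AE_I2)
        fix t
        have "cmod (?R y (w + Complex c t) * ?E t) \<le>
          C * (2 * K) ^ Suc N * cmod (Complex c t) powr (real N + 1) * (exp (x * c) * cmod (Complex c t) powr - (k + 1))"
          unfolding norm_mult[of "?R y (w + Complex c t)"] cmod_perron_integrand
          by (rule mult_mono[OF R_bd[OF elim]]) (use C0 in \<open>auto simp: K_def\<close>)
        also have "\<dots> = ?W t"
          by (simp add: powr_add[symmetric] mult_ac)
        finally show "cmod (?R y (w + Complex c t) * ?E t) \<le> ?W t" .
      qed
    qed
  qed
  \<comment> \<open>Once y >= x, the kernel removes all indices with lam n >= x, so the index set is
    fixed and only the weights (1 - lam n / y)^N still depend on y.\<close>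
  moreover have "\<forall>\<^sub>F y in at_top. perron_integral (?R y) w k c x
      = perron_kernel k 1 1 * (\<Sum>n | lam n < x. a n * of_real ((1 - lam n / y) powr real N) * exp (- of_real (lam n) * w) * of_real ((x - lam n) powr k))"
    using eventually_ge_at_top[of x]
  proof eventually_elim
    case (elim y)
    have "perron_integral (?R y) w k c x = perron_integral (\<lambda>s. \<Sum>n | lam n < y. (a n * of_real ((1 - lam n / y) powr real N)) * exp (- of_real (lam n) * s)) w k c x"
      unfolding riesz_mean_def by (simp add: mult_ac)
    also have "\<dots> = perron_kernel k 1 1 * (\<Sum>n | lam n < y. a n * of_real ((1 - lam n / y) powr real N) * exp (- of_real (lam n) * w) * of_real (max 0 (x - lam n) powr k))"
      by (rule perron_integral_dirichlet_polynomial) (use frequency_finite_below[OF lam] k c0 in auto)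
    also have "(\<Sum>n | lam n < y. a n * of_real ((1 - lam n / y) powr real N) * exp (- of_real (lam n) * w) * of_real (max 0 (x - lam n) powr k))
      = (\<Sum>n | lam n < x. a n * of_real ((1 - lam n / y) powr real N) * exp (- of_real (lam n) * w) * of_real ((x - lam n) powr k))"
      using elim frequency_finite_below[OF lam] by (intro sum.mono_neutral_cong_right) (auto simp: max_def)
    finally show ?case .
  qed
  moreover have "((\<lambda>y. perron_kernel k 1 1 * (\<Sum>n | lam n < x. a n * of_real ((1 - lam n / y) powr real N) * exp (- of_real (lam n) * w) * of_real ((x - lam n) powr k)))
      \<longlongrightarrow> perron_kernel k 1 1 * riesz_sum lam a k x w) at_top"
    unfolding riesz_sum_def
  proof (intro tendsto_mult tendsto_const tendsto_sum)
    fix n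
    have "((\<lambda>y. (1 - lam n / y) powr real N) \<longlongrightarrow> (1 - 0) powr real N) at_top"
      by (intro tendsto_intros tendsto_divide_0[OF tendsto_const] filterlim_at_top_imp_at_infinity filterlim_ident) auto
    then have "((\<lambda>y. complex_of_real ((1 - lam n / y) powr real N)) \<longlongrightarrow> 1) at_top"
      using tendsto_of_real by fastforce
    from tendsto_mult[OF tendsto_const[of "a n"] this]
    show "((\<lambda>y. a n * of_real ((1 - lam n / y) powr real N)) \<longlongrightarrow> a n) at_top" by simp
  qed
  ultimately have "((\<lambda>y. perron_integral (?R y) w k c x) \<longlongrightarrow> perron_kernel k 1 1 * riesz_sum lam a k x w) at_top"
    using tendsto_cong by fastforce
  with \<open>((\<lambda>y. perron_integral (?R y) w k c x) \<longlongrightarrow> perron_integral f w k c x) at_top\<close>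
  show ?thesis using tendsto_unique[OF trivial_limit_at_top_linorder] by blast
qed

section \<open>Differentiation of Perron integrals and Riesz sums in x\<close>

lemma cmod_exp_minus_one_le: "cmod (exp w - 1) \<le> exp \<bar>Re w\<bar> * cmod w"
proof -
  have "cmod (exp w - exp 0) \<le> exp \<bar>Re w\<bar> * cmod (w - 0)"
  proof (rule field_differentiable_bound[OF convex_halfspace_Re_le[of "\<bar>Re w\<bar>"]])
    show "(exp has_field_derivative exp z) (at z within {z. Re z \<le> \<bar>Re w\<bar>})" for z :: complex
      by (rule DERIV_subset[OF DERIV_exp]) simp
  qed auto
  then show ?thesis by simp
qed

text \<open>Difference quotients along a null sequence h_i are dominated: on Re z = c one has
  |exp(h_i z) - 1| / |h_i| <= exp(K |c|) |z| with K bounding all |h_i|, so z G supplies the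
  integrable majorant.\<close>

lemma has_vector_derivative_line_integral:
  assumes G: "integrable lborel G" and zG: "integrable lborel (\<lambda>t. Complex c t * G t)"
  shows "((\<lambda>x. LINT t|lborel. G t * exp (of_real x * Complex c t)) has_vector_derivative
    (LINT t|lborel. Complex c t * G t * exp (of_real x * Complex c t))) (at x)"
proof -
  let ?z = "Complex c"
  let ?g = "\<lambda>x. LINT t|lborel. G t * exp (of_real x * ?z t)"
  let ?D = "LINT t|lborel. ?z t * G t * exp (of_real x * ?z t)"
  have G_meas [measurable]: "G \<in> borel_measurable borel" using G by auto
  have int: "integrable lborel (\<lambda>t. G t * exp (of_real y * ?z t))" for y
  proof (rule Bochner_Integration.integrable_bound)
    show "integrable lborel (\<lambda>t. exp (y * c) * cmod (G t))" using G by simp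
  qed (auto simp: norm_mult)
  have lim: "((\<lambda>h. (?g (x + h) - ?g x) /\<^sub>R h) \<longlongrightarrow> ?D) (at 0)"
    unfolding tendsto_at_iff_sequentially o_def
  proof (intro allI impI)
    fix X :: "nat \<Rightarrow> real" assume X0: "\<forall>i. X i \<in> UNIV - {0}" and X: "X \<longlonglongrightarrow> 0"
    obtain K where K: "\<And>i. \<bar>X i\<bar> \<le> K"
      using convergent_imp_Bseq[OF convergentI[OF X]] by (auto simp: Bseq_def)
    let ?s = "\<lambda>i t. G t * exp (of_real x * ?z t) * ((exp (of_real (X i) * ?z t) - 1) /\<^sub>R X i)"
    have "(\<lambda>i. LINT t|lborel. ?s i t) \<longlonglongrightarrow> ?D"
    proof (rule integral_dominated_convergence)
      show "integrable lborel (\<lambda>t. exp (K * \<bar>c\<bar>) * exp (x * c) * cmod (?z t * G t))"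
        using zG by simp
      show "AE t in lborel. (\<lambda>i. ?s i t) \<longlonglongrightarrow> ?z t * G t * exp (of_real x * ?z t)"
      proof (intro AE_I2)
        fix t
        have "((\<lambda>h::real. exp (of_real h * ?z t)) has_vector_derivative ?z t) (at 0)"
          by (auto intro!: derivative_eq_intros has_vector_derivative_real_field)
        then have "((\<lambda>h::real. norm (exp (of_real h * ?z t) - 1 - h *\<^sub>R ?z t) / norm h) \<longlongrightarrow> 0) (at 0)"
          unfolding has_vector_derivative_def has_derivative_at by simp
        then have "((\<lambda>i. norm (exp (of_real (X i) * ?z t) - 1 - X i *\<^sub>R ?z t) / norm (X i)) \<longlonglongrightarrow> 0)"
          by (rule filterlim_compose) (use X X0 in \<open>auto simp: filterlim_at\<close>)
        moreover have "norm (exp (of_real (X i) * ?z t) - 1 - X i *\<^sub>R ?z t) / norm (X i)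
            = norm ((exp (of_real (X i) * ?z t) - 1) /\<^sub>R X i - ?z t)" for i
        proof -
          have "X i \<noteq> 0" using X0 by simp
          then have "(exp (of_real (X i) * ?z t) - 1) /\<^sub>R X i - ?z t
              = (exp (of_real (X i) * ?z t) - 1 - X i *\<^sub>R ?z t) /\<^sub>R X i"
            by (simp add: scaleR_diff_right)
          then show ?thesis by (simp add: divide_inverse_commute)
        qed
        ultimately have "(\<lambda>i. (exp (of_real (X i) * ?z t) - 1) /\<^sub>R X i) \<longlonglongrightarrow> ?z t"
          by (simp add: tendsto_norm_zero_iff Lim_null[symmetric])
        from tendsto_mult[OF tendsto_const[of "G t * exp (of_real x * ?z t)"] this]
        show "(\<lambda>i. ?s i t) \<longlonglongrightarrow> ?z t * G t * exp (of_real x * ?z t)"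
          by (simp add: mult_ac)
      qed
      show "AE t in lborel. cmod (?s i t) \<le> exp (K * \<bar>c\<bar>) * exp (x * c) * cmod (?z t * G t)" for i
      proof (intro AE_I2)
        fix t
        have Xi: "X i \<noteq> 0" using X0 by simp
        have "cmod (exp (of_real (X i) * ?z t) - 1) \<le> exp \<bar>X i * c\<bar> * (\<bar>X i\<bar> * cmod (?z t))"
          using cmod_exp_minus_one_le[of "of_real (X i) * ?z t"] by (simp add: norm_mult)
        also have "\<dots> \<le> exp (K * \<bar>c\<bar>) * (\<bar>X i\<bar> * cmod (?z t))"
          using K[of i] by (intro mult_right_mono) (auto simp: abs_mult intro: mult_right_mono)
        finally have "cmod (exp (of_real (X i) * ?z t) - 1) / \<bar>X i\<bar> \<le> exp (K * \<bar>c\<bar>) * cmod (?z t)"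
          using Xi by (simp add: pos_divide_le_eq mult_ac)
        then have "cmod ((exp (of_real (X i) * ?z t) - 1) /\<^sub>R X i) \<le> exp (K * \<bar>c\<bar>) * cmod (?z t)"
          by (simp add: divide_inverse_commute)
        then have "cmod (G t) * exp (x * c) * cmod ((exp (of_real (X i) * ?z t) - 1) /\<^sub>R X i)
            \<le> cmod (G t) * exp (x * c) * (exp (K * \<bar>c\<bar>) * cmod (?z t))"
          by (rule mult_left_mono) simp
        then show "cmod (?s i t) \<le> exp (K * \<bar>c\<bar>) * exp (x * c) * cmod (?z t * G t)"
          by (simp only: norm_mult norm_exp_eq_Re) (simp add: mult_ac)
      qed
    qed measurable
    moreover have "(LINT t|lborel. ?s i t) = (?g (x + X i) - ?g x) /\<^sub>R X i" for i
    proof -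
      have "(?g (x + X i) - ?g x) /\<^sub>R X i
          = (LINT t|lborel. (G t * exp (of_real (x + X i) * ?z t) - G t * exp (of_real x * ?z t)) /\<^sub>R X i)"
        using Bochner_Integration.integral_diff[OF int[of "x + X i"] int[of x]] by simp
      also have "\<dots> = (LINT t|lborel. ?s i t)"
        by (intro Bochner_Integration.integral_cong) (auto simp: distrib_right exp_add algebra_simps)
      finally show ?thesis by (rule sym)
    qed
    ultimately show "(\<lambda>i. (?g (x + X i) - ?g x) /\<^sub>R X i) \<longlonglongrightarrow> ?D" by (simp only:)
  qed
  have "((\<lambda>h. norm ((?g (x + h) - ?g x) /\<^sub>R h - ?D)) \<longlongrightarrow> 0) (at 0)"
    using lim by (simp add: tendsto_norm_zero_iff Lim_null[symmetric])
  moreover have "\<forall>\<^sub>F h in at 0. norm ((?g (x + h) - ?g x) /\<^sub>R h - ?D) = norm (?g (x + h) - ?g x - h *\<^sub>R ?D) / norm h"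
    unfolding eventually_at_filter
  proof (intro always_eventually allI impI)
    fix h :: real assume "h \<noteq> 0"
    then have "(?g (x + h) - ?g x) /\<^sub>R h - ?D = (?g (x + h) - ?g x - h *\<^sub>R ?D) /\<^sub>R h"
      by (simp add: scaleR_diff_right)
    then show "norm ((?g (x + h) - ?g x) /\<^sub>R h - ?D) = norm (?g (x + h) - ?g x - h *\<^sub>R ?D) / norm h"
      by (simp add: divide_inverse_commute)
  qed
  ultimately have "((\<lambda>h. norm (?g (x + h) - ?g x - h *\<^sub>R ?D) / norm h) \<longlongrightarrow> 0) (at 0)"
    using tendsto_cong by fastforce
  then show ?thesis
    unfolding has_vector_derivative_def has_derivative_at by (simp add: bounded_linear_scaleR_left)
qed

lemma perron_integrand_mult_holomorphic:
  assumes "f holomorphic_on right_halfplane 0" and "0 < Re w"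
  shows "(\<lambda>z. f (w + z) * (exp (of_real x * z) * z powr of_real a)) holomorphic_on {z. 0 < Re z}"
  by (intro holomorphic_on_mult perron_integrand_holomorphic holomorphic_on_compose_gen[OF _ assms(1), unfolded o_def]
      holomorphic_intros powr_holomorphic_halfplane)
     (use assms(2) in \<open>auto intro!: holomorphic_intros simp: right_halfplane_def\<close>)

lemma perron_integrand_integrable:
  assumes hol: "f holomorphic_on right_halfplane 0" and w: "0 < Re w" and c: "0 < c" and k: "l < k"
    and bd: "\<And>t. cmod (f (w + Complex c t)) \<le> A * cmod (Complex c t) powr l"
  shows "integrable lborel (\<lambda>t. f (w + Complex c t) * (exp (of_real x * Complex c t) * Complex c t powr of_real (- k - 1)))"
proof (rule line_integrable[OF perron_integrand_mult_holomorphic[OF hol w] c, where a = "k + 1 - l" and C = "A * exp (x * c)"])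
  fix t
  have "cmod (f (w + Complex c t) * (exp (of_real x * Complex c t) * Complex c t powr of_real (- k - 1)))
      \<le> (A * cmod (Complex c t) powr l) * (exp (x * c) * cmod (Complex c t) powr - (k + 1))"
    unfolding norm_mult[of "f (w + Complex c t)"] cmod_perron_integrand complex.sel
    by (rule mult_right_mono[OF bd]) simp
  also have "\<dots> = A * exp (x * c) * (cmod (Complex c t) powr l * cmod (Complex c t) powr - (k + 1))" by simp
  also have "cmod (Complex c t) powr l * cmod (Complex c t) powr - (k + 1) = cmod (Complex c t) powr - (k + 1 - l)"
    unfolding powr_add[symmetric] by (simp add: algebra_simps)
  finally show "cmod (f (w + Complex c t) * (exp (of_real x * Complex c t) * Complex c t powr of_real (- k - 1)))
      \<le> A * exp (x * c) * cmod (Complex c t) powr - (k + 1 - l)" .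
qed (use k in auto)

text \<open>The derivative brings down a factor z, which lowers the order from k + 1 to k. The
  integrand of order k decays like |z|^(l-k-1), so the descent has to stop at l.\<close>

lemma perron_integral_has_vector_derivative:
  assumes hol: "f holomorphic_on right_halfplane 0" and w: "0 < Re w" and c: "0 < c" and k: "l < k"
    and bd: "\<And>t. cmod (f (w + Complex c t)) \<le> A * cmod (Complex c t) powr l"
  shows "(perron_integral f w (k + 1) c has_vector_derivative perron_integral f w k c x) (at x)"
proof -
  define G where "G = (\<lambda>t. f (w + Complex c t) * Complex c t powr of_real (- (k + 1) - 1))"
  have hol': "(\<lambda>z. f (w + z) * z powr of_real b) holomorphic_on {z. 0 < Re z}" for b
    by (intro holomorphic_on_mult powr_holomorphic_halfplane holomorphic_on_compose_gen[OF _ hol, unfolded o_def])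
       (use w in \<open>auto intro!: holomorphic_intros simp: right_halfplane_def\<close>)
  have i: "integrable lborel (\<lambda>t. f (w + Complex c t) * Complex c t powr of_real b)" if b: "b + l < - 1" for b
  proof (rule line_integrable[OF hol' c, where a = "- (b + l)" and C = A])
    fix t
    have "cmod (f (w + Complex c t) * Complex c t powr of_real b)
        \<le> A * cmod (Complex c t) powr l * cmod (Complex c t) powr b"
      using bd by (auto simp: norm_mult norm_powr_real_powr' intro: mult_right_mono)
    then show "cmod (f (w + Complex c t) * Complex c t powr of_real b) \<le> A * cmod (Complex c t) powr - (- (b + l))"
      by (simp add: powr_add mult_ac)
  qed (use b in auto)
  have e: "Complex c t * G t = f (w + Complex c t) * Complex c t powr of_real (- k - 1)" for t
  proof -
    have "Complex c t \<noteq> 0" using c by (auto simp: complex_eq_iff)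
    have "complex_of_real (- k - 1) = of_real (- (k + 1) - 1) + 1" by simp
    then have "Complex c t powr of_real (- k - 1) = Complex c t powr of_real (- (k + 1) - 1) * Complex c t powr 1"
      by (simp only: powr_add)
    then show ?thesis using \<open>Complex c t \<noteq> 0\<close> by (simp add: G_def mult_ac)
  qed
  have "((\<lambda>x. LINT t|lborel. G t * exp (of_real x * Complex c t)) has_vector_derivative
    (LINT t|lborel. Complex c t * G t * exp (of_real x * Complex c t))) (at x)"
  proof (rule has_vector_derivative_line_integral)
    show "integrable lborel G" unfolding G_def by (rule i) (use k in simp)
    show "integrable lborel (\<lambda>t. Complex c t * G t)" unfolding e by (rule i) (use k in simp)
  qed
  then show ?thesis
    unfolding e by (simp add: perron_integral_def[abs_def] G_def mult_ac)
qed

text \<open>Only the corner x = r is delicate: there the difference quotient is at most |h|^k, which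
  tends to 0 since k > 0.\<close>

lemma max_powr_has_real_derivative:
  assumes k: "0 < k"
  shows "((\<lambda>x. max 0 (x - r) powr (k + 1)) has_real_derivative (k + 1) * max 0 (x - r) powr k) (at x)"
proof (cases x r rule: linorder_cases)
  case less
  have "((\<lambda>x. max 0 (x - r) powr (k + 1)) has_real_derivative 0) (at x)"
    by (rule has_field_derivative_transform_within_open[OF DERIV_const, of "{..<r}"]) (use less in auto)
  then show ?thesis using less by simp
next
  case greater
  have "((\<lambda>x. (x - r) powr (k + 1)) has_real_derivative (k + 1) * (x - r) powr k) (at x)"
    using greater by (auto intro!: derivative_eq_intros)
  then have "((\<lambda>x. max 0 (x - r) powr (k + 1)) has_real_derivative (k + 1) * (x - r) powr k) (at x)"
    by (rule has_field_derivative_transform_within_open[of _ _ _ "{r<..}"]) (use greater in auto)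
  then show ?thesis using greater by simp
next
  case equal
  have "((\<lambda>h. max 0 h powr (k + 1) / h) \<longlongrightarrow> 0) (at 0)"
  proof (rule Lim_null_comparison)
    show "\<forall>\<^sub>F h in at 0. norm (max 0 h powr (k + 1) / h) \<le> \<bar>h\<bar> powr k"
      by (intro always_eventually) (auto simp: max_def powr_add)
    show "((\<lambda>h::real. \<bar>h\<bar> powr k) \<longlongrightarrow> 0) (at 0)"
      by (rule tendsto_zero_powrI) (use k in \<open>auto intro!: tendsto_eq_intros\<close>)
  qed
  then show ?thesis using equal k by (simp add: DERIV_def)
qed

lemma riesz_sum_has_vector_derivative:
  assumes lam: "frequency lam" and k: "0 < k"
  shows "((\<lambda>x. riesz_sum lam a (k + 1) x w) has_vector_derivative of_real (k + 1) * riesz_sum lam a k x w) (at x)"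
proof -
  \<comment> \<open>The bound x + 1 gives one finite index set valid for all points near x; with
    \<open>max 0\<close> the extra terms vanish and the sum can be differentiated termwise.\<close>
  define F where "F = {n. lam n < x + 1}"
  have fin: "finite F" unfolding F_def by (rule frequency_finite_below[OF lam])
  have e: "riesz_sum lam a k y w = (\<Sum>n\<in>F. a n * exp (- of_real (lam n) * w) * of_real (max 0 (y - lam n) powr k))"
    if "y < x + 1" for y k
    unfolding riesz_sum_def F_def
    by (intro sum.mono_neutral_cong_left) (use that fin[unfolded F_def] in \<open>auto simp: max_def\<close>)
  have "((\<lambda>y. \<Sum>n\<in>F. a n * exp (- of_real (lam n) * w) * of_real (max 0 (y - lam n) powr (k + 1))) has_vector_derivative
      (\<Sum>n\<in>F. a n * exp (- of_real (lam n) * w) * of_real ((k + 1) * max 0 (x - lam n) powr k))) (at x)"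
    by (intro has_vector_derivative_sum has_vector_derivative_mult_right has_vector_derivative_of_real
        max_powr_has_real_derivative k)
  then have "((\<lambda>y. riesz_sum lam a (k + 1) y w) has_vector_derivative
      (\<Sum>n\<in>F. a n * exp (- of_real (lam n) * w) * of_real ((k + 1) * max 0 (x - lam n) powr k))) (at x)"
    by (rule has_vector_derivative_transform_within_open[of _ _ _ "{..<x + 1}"]) (auto simp: e)
  then show ?thesis by (simp add: e sum_distrib_left mult_ac)
qed

text \<open>The functional equation Gamma(k + 2) = (k + 1) Gamma(k + 1) in disguise: the kernel of
  order k + 1 is differentiated at y = 1, once under the integral as the Perron integral of the
  constant 1 and once as a multiple of y^(k+1).\<close>

lemma perron_kernel_Suc:
  assumes k: "0 < k"
  shows "perron_kernel k 1 1 = of_real (k + 1) * perron_kernel (k + 1) 1 1"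
proof -
  have p: "perron_kernel k 1 = perron_integral (\<lambda>_. 1) 1 k 1" for k
    by (simp add: perron_kernel_def perron_integral_def fun_eq_iff)
  have "(perron_integral (\<lambda>_. 1) 1 (k + 1) 1 has_vector_derivative perron_integral (\<lambda>_. 1) 1 k 1 1) (at 1)"
  proof (rule perron_integral_has_vector_derivative[where l = 0 and A = 1])
    show "cmod 1 \<le> 1 * cmod (Complex 1 t) powr 0" for t
      by (auto simp: complex_eq_iff)
  qed (use k in auto)
  then have "((\<lambda>y. perron_kernel (k + 1) 1 y) has_vector_derivative perron_kernel k 1 1) (at 1)"
    unfolding p .
  moreover have "((\<lambda>y. perron_kernel (k + 1) 1 y) has_vector_derivative of_real (k + 1) * perron_kernel (k + 1) 1 1) (at 1)"
  proof -
    have "((\<lambda>y. of_real (max 0 (y - 0) powr (k + 1)) * perron_kernel (k + 1) 1 1) has_vector_derivative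
        of_real ((k + 1) * max 0 (1 - 0) powr k) * perron_kernel (k + 1) 1 1) (at 1)"
      by (intro has_vector_derivative_mult_left has_vector_derivative_of_real max_powr_has_real_derivative k)
    then have "((\<lambda>y. perron_kernel (k + 1) 1 y) has_vector_derivative
        of_real ((k + 1) * max 0 (1 - 0) powr k) * perron_kernel (k + 1) 1 1) (at 1)"
      by (rule has_vector_derivative_transform_within_open[of _ _ _ UNIV])
         (use perron_kernel_eq[of "k + 1" 1, symmetric] k in auto)
    then show ?thesis by simp
  qed
  ultimately show ?thesis by (rule vector_derivative_unique_at)
qed

section \<open>Perron's formula for all orders k > l and uniqueness of the germ\<close>

lemma polynomial_growth_shift:
  fixes f :: "complex \<Rightarrow> complex"
  assumes growth: "\<And>s. 0 < Re s \<Longrightarrow> cmod (f s) \<le> C * (1 + cmod s) powr l"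
    and w: "0 < Re w" and c: "0 < c" "c \<le> Re z" and l: "0 \<le> l" and C: "0 \<le> C"
  shows "cmod (f (w + z)) \<le> C * ((1 + cmod w) / c + 1) powr l * cmod z powr l"
proof -
  \<comment> \<open>As |z| >= c, the summand 1 + |w| is absorbed into a multiple of |z|. The
    resulting constant depends on w, which is harmless because it never enters the error
    estimate.\<close>
  have "c \<le> cmod z" using c complex_Re_le_cmod[of z] by linarith
  then have "(1 + cmod w) * 1 \<le> (1 + cmod w) * (cmod z / c)"
    using c by (intro mult_left_mono) auto
  then have "1 + cmod (w + z) \<le> ((1 + cmod w) / c + 1) * cmod z"
    using norm_triangle_ineq[of w z] by (simp add: algebra_simps)
  then have "(1 + cmod (w + z)) powr l \<le> (((1 + cmod w) / c + 1) * cmod z) powr l"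
    using l by (intro powr_mono2) auto
  also have "\<dots> = ((1 + cmod w) / c + 1) powr l * cmod z powr l"
    using c by (subst powr_mult) auto
  finally have "C * (1 + cmod (w + z)) powr l \<le> C * (((1 + cmod w) / c + 1) powr l * cmod z powr l)"
    using C by (rule mult_left_mono)
  with growth[of "w + z"] w c show ?thesis by (simp add: mult.assoc)
qed

lemma perron_formula:
  assumes lam: "frequency lam" and germ: "riesz_germ lam a f"
    and hol: "f holomorphic_on right_halfplane 0"
    and growth: "\<And>s. 0 < Re s \<Longrightarrow> cmod (f s) \<le> C * (1 + cmod s) powr l"
    and C: "0 \<le> C" and l: "0 \<le> l" and k: "l < k" and w: "0 < Re w" and c: "0 < c" and x: "0 < x"
  shows "perron_integral f w k c x = perron_kernel k 1 1 * riesz_sum lam a k x w"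
proof -
  obtain N :: nat and \<sigma> where \<sigma>: "0 \<le> \<sigma>"
    and conv: "\<And>s. \<sigma> < Re s \<Longrightarrow> ((\<lambda>x. riesz_mean lam a (real N) x s) \<longlongrightarrow> f s) at_top"
    by (rule riesz_germ_integer_order[OF lam germ]) (rule that)
  define c1 where "c1 = \<sigma> + 2 + c"
  have c1: "0 < c1" "\<sigma> + 2 \<le> c1" "c < c1" using \<sigma> c by (auto simp: c1_def)
  define K where "K = C * ((1 + cmod w) / c + 1) powr l"
  have f_bd: "cmod (f (w + z)) \<le> K * cmod z powr l" if "c \<le> Re z" for z
    unfolding K_def by (rule polynomial_growth_shift[OF growth w c that l C])
  \<comment> \<open>n counts the differentiations needed to come down from an order above N + 1. The
    point x stays arbitrary, because the formula of order k + 1 must hold near x before it can be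
    differentiated.\<close>
  have down: "perron_integral f w k c1 x = perron_kernel k 1 1 * riesz_sum lam a k x w"
    if "real N + 1 < k + real n" "l < k" "0 < x" for n k x
    using that
  proof (induction n arbitrary: k x)
    case 0
    then show ?case by (intro perron_formula_high_order[OF lam \<sigma> conv hol _ w c1(2)]) auto
  next
    case (Suc n)
    have k0: "0 < k" using Suc.prems l by linarith
    have IH: "perron_integral f w (k + 1) c1 y = perron_kernel (k + 1) 1 1 * riesz_sum lam a (k + 1) y w"
      if "0 < y" for y
      by (rule Suc.IH) (use Suc.prems that in auto)
    have "(perron_integral f w (k + 1) c1 has_vector_derivative perron_integral f w k c1 x) (at x)"
      by (rule perron_integral_has_vector_derivative[OF hol w c1(1) Suc.prems(2), where A = K])
         (use c1 in \<open>auto intro: f_bd\<close>)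
    moreover have "(perron_integral f w (k + 1) c1 has_vector_derivative
        perron_kernel (k + 1) 1 1 * (of_real (k + 1) * riesz_sum lam a k x w)) (at x)"
    proof (rule has_vector_derivative_transform_within_open[of _ _ _ "{0<..}"])
      show "((\<lambda>y. perron_kernel (k + 1) 1 1 * riesz_sum lam a (k + 1) y w) has_vector_derivative
          perron_kernel (k + 1) 1 1 * (of_real (k + 1) * riesz_sum lam a k x w)) (at x)"
        by (intro has_vector_derivative_mult_right riesz_sum_has_vector_derivative lam k0)
    qed (use IH Suc.prems in auto)
    ultimately have "perron_integral f w k c1 x = perron_kernel (k + 1) 1 1 * (of_real (k + 1) * riesz_sum lam a k x w)"
      by (rule vector_derivative_unique_at)
    then show ?case unfolding perron_kernel_Suc[OF k0] by simp
  qed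
  obtain n :: nat where "real N + 1 - k < real n" using reals_Archimedean2 by blast
  then have "perron_integral f w k c1 x = perron_kernel k 1 1 * riesz_sum lam a k x w"
    by (intro down[of _ n] k x) auto
  \<comment> \<open>The means are known to converge to f only right of \<sigma>, so the descent ran
    on a line beyond \<sigma> + 2; f itself is holomorphic and of growth l on the whole half plane,
    so the line can be moved back.\<close>
  moreover have "perron_integral f w k c x = perron_integral f w k c1 x"
    unfolding perron_integral_def
  proof (rule line_integral_shift[OF perron_integrand_mult_holomorphic[OF hol w], where a = "k + 1 - l" and C = "K * exp (x * c1)"])
    fix z assume z: "c \<le> Re z" "Re z \<le> c1"
    have "cmod (f (w + z) * (exp (of_real x * z) * z powr of_real (- k - 1)))
        \<le> (K * cmod z powr l) * (exp (x * c1) * cmod z powr - (k + 1))"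
      unfolding norm_mult[of "f (w + z)"] cmod_perron_integrand
      using f_bd[OF z(1)] z x C by (intro mult_mono mult_right_mono) (auto simp: K_def)
    also have "\<dots> = K * exp (x * c1) * (cmod z powr l * cmod z powr - (k + 1))" by simp
    also have "cmod z powr l * cmod z powr - (k + 1) = cmod z powr - (k + 1 - l)"
      unfolding powr_add[symmetric] by (simp add: algebra_simps)
    finally show "cmod (f (w + z) * (exp (of_real x * z) * z powr of_real (- k - 1)))
        \<le> K * exp (x * c1) * cmod z powr - (k + 1 - l)" .
  qed (use c c1 k in auto)
  ultimately show ?thesis by simp
qed

text \<open>Both Riesz sums, times the same nonzero constant, equal one Perron integral; l + 1 is
  just an order above l. At x = lam (n + 1) the sum contains exactly the coefficients up to n, with
  nonzero weights, so each one is determined by its predecessors.\<close>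

lemma riesz_germ_unique:
  assumes lam: "frequency lam" and germ: "riesz_germ lam a f" "riesz_germ lam b f"
    and hol: "f holomorphic_on right_halfplane 0"
    and growth: "\<And>s. 0 < Re s \<Longrightarrow> cmod (f s) \<le> C * (1 + cmod s) powr l"
    and C: "0 \<le> C" and l: "0 \<le> l"
  shows "a = b"
proof
  fix n
  have mono: "lam i < lam j \<longleftrightarrow> i < j" for i j
    using lam by (simp add: frequency_def strict_mono_less)
  have eq: "riesz_sum lam a (l + 1) x 1 = riesz_sum lam b (l + 1) x 1" if "0 < x" for x
  proof -
    have "perron_kernel (l + 1) 1 1 * riesz_sum lam a (l + 1) x 1 = perron_integral f 1 (l + 1) 1 x"
      by (rule perron_formula[OF lam germ(1) hol growth C l, symmetric]) (use that in auto)
    also have "\<dots> = perron_kernel (l + 1) 1 1 * riesz_sum lam b (l + 1) x 1"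
      by (rule perron_formula[OF lam germ(2) hol growth C l]) (use that in auto)
    finally have "perron_kernel (l + 1) 1 1 * riesz_sum lam a (l + 1) x 1 = perron_kernel (l + 1) 1 1 * riesz_sum lam b (l + 1) x 1" .
    moreover have "perron_kernel (l + 1) 1 1 \<noteq> 0" using perron_kernel_nonzero l by simp
    ultimately show ?thesis by (simp only: mult_cancel_left) simp
  qed
  show "a n = b n"
  proof (induction n rule: less_induct)
    case (less n)
    have F: "{i. lam i < lam (Suc n)} = insert n {..<n}"
      unfolding mono by auto
    have pos: "0 < lam (Suc n)" using mono[of n "Suc n"] frequency_nonneg[OF lam, of n] by simp
    have "(\<Sum>i<n. a i * exp (- of_real (lam i) * 1) * of_real ((lam (Suc n) - lam i) powr (l + 1)))
        = (\<Sum>i<n. b i * exp (- of_real (lam i) * 1) * of_real ((lam (Suc n) - lam i) powr (l + 1)))"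
      by (intro sum.cong) (auto simp: less)
    with eq[OF pos] have "a n * exp (- of_real (lam n) * 1) * of_real ((lam (Suc n) - lam n) powr (l + 1))
        = b n * exp (- of_real (lam n) * 1) * of_real ((lam (Suc n) - lam n) powr (l + 1))"
      unfolding riesz_sum_def F by simp
    moreover have "lam (Suc n) - lam n \<noteq> 0" using mono[of n "Suc n"] by simp
    ultimately show ?case by simp
  qed
qed

section \<open>The approximation error\<close>

text \<open>In the constant, 2 / u * (2 + u / 2)^l comes from Cauchy's inequality on discs of radius
  u / 2, and 1 + 2^l from the triangle inequality for |z| > 1. It depends on f only through C and
  not on w, which makes the final estimate uniform.\<close>

lemma increment_bound:
  fixes f :: "complex \<Rightarrow> complex"
  assumes hol: "f holomorphic_on right_halfplane 0"
    and growth: "\<And>s. 0 < Re s \<Longrightarrow> cmod (f s) \<le> C * (1 + cmod s) powr l"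
    and C: "0 \<le> C" and l: "0 \<le> l" and u: "0 < u" "u \<le> Re w" and z: "0 < Re z"
    and pq: "0 < p" "p \<le> 1" "l \<le> q"
  shows "cmod (f w - f (w + z))
    \<le> C * (2 / u * (2 + u / 2) powr l + 1 + 2 powr l) * (1 + cmod w) powr l * (cmod z powr p + cmod z powr q)"
proof (cases "cmod z \<le> 1")
  case True
  \<comment> \<open>A bound for f on the circles of radius u / 2 about points \<zeta> with |\<zeta>|
    <= |w| + 1: there 1 + |x| <= 2 + u / 2 + |w| <= (2 + u / 2) (1 + |w|).\<close>
  define B where "B = C * ((2 + u / 2) * (1 + cmod w)) powr l"
  have B: "0 \<le> B" using C by (simp add: B_def)
  have d: "cmod (deriv f \<zeta>) \<le> B / (u / 2)" if \<zeta>: "u \<le> Re \<zeta>" "cmod \<zeta> \<le> cmod w + 1" for \<zeta>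
  proof -
    have sub: "cball \<zeta> (u / 2) \<subseteq> right_halfplane 0"
    proof
      fix x assume "x \<in> cball \<zeta> (u / 2)"
      then have "Re (\<zeta> - x) \<le> u / 2"
        using complex_Re_le_cmod[of "\<zeta> - x"] by (simp add: dist_norm)
      then show "x \<in> right_halfplane 0" using u \<zeta> by (simp add: right_halfplane_def)
    qed
    have "norm ((deriv ^^ 1) f \<zeta>) \<le> fact 1 * B / (u / 2) ^ 1"
    proof (rule Cauchy_inequality)
      show "f holomorphic_on ball \<zeta> (u / 2)"
        using hol by (rule holomorphic_on_subset) (use sub in auto)
      show "continuous_on (cball \<zeta> (u / 2)) f"
        using holomorphic_on_imp_continuous_on[OF hol] sub by (rule continuous_on_subset)
      fix x assume x: "norm (\<zeta> - x) = u / 2"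
      then have "x \<in> right_halfplane 0" using sub by (auto simp: dist_norm)
      then have "cmod (f x) \<le> C * (1 + cmod x) powr l"
        by (intro growth) (simp add: right_halfplane_def)
      also have "\<dots> \<le> B"
        unfolding B_def
      proof (intro mult_left_mono powr_mono2 C l)
        have "cmod x \<le> cmod \<zeta> + u / 2"
          using norm_triangle_ineq4[of \<zeta> "\<zeta> - x"] x by simp
        then have "1 + cmod x \<le> (2 + u / 2) + cmod w" using \<zeta> by simp
        also have "\<dots> \<le> (2 + u / 2) * (1 + cmod w)"
          using mult_right_mono[of 1 "2 + u / 2" "cmod w"] u unfolding distrib_left mult_1_right by simp
        finally show "1 + cmod x \<le> (2 + u / 2) * (1 + cmod w)" .
      qed simp
      finally show "norm (f x) \<le> B" .
    qed (use u in simp)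
    then show ?thesis by simp
  qed
  have seg: "u \<le> Re \<zeta> \<and> cmod \<zeta> \<le> cmod w + 1" if "\<zeta> \<in> closed_segment w (w + z)" for \<zeta>
  proof -
    from that have "\<exists>r\<ge>0. r \<le> 1 \<and> \<zeta> = (1 - r) *\<^sub>R w + r *\<^sub>R (w + z)"
      by (simp only: in_segment)
    then obtain r where r: "0 \<le> r" "r \<le> 1" "\<zeta> = (1 - r) *\<^sub>R w + r *\<^sub>R (w + z)"
      by (elim exE conjE)
    then have \<zeta>: "\<zeta> = w + r *\<^sub>R z" by (simp add: algebra_simps)
    have "cmod (r *\<^sub>R z) \<le> 1" using r True mult_mono[of r 1 "cmod z" 1] by simp
    then show ?thesis
      unfolding \<zeta> using norm_triangle_ineq[of w "r *\<^sub>R z"] u z r by (auto simp: add_increasing2)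
  qed
  have "cmod (f (w + z) - f w) \<le> B / (u / 2) * cmod (w + z - w)"
  proof (rule field_differentiable_bound[OF convex_closed_segment])
    fix \<zeta> assume \<zeta>: "\<zeta> \<in> closed_segment w (w + z)"
    have "\<zeta> \<in> right_halfplane 0" using seg[OF \<zeta>] u by (simp add: right_halfplane_def)
    then have "(f has_field_derivative deriv f \<zeta>) (at \<zeta>)"
      by (rule holomorphic_derivI[OF hol, rotated]) (simp add: right_halfplane_def open_halfspace_Re_gt)
    then show "(f has_field_derivative deriv f \<zeta>) (at \<zeta> within closed_segment w (w + z))"
      by (rule has_field_derivative_at_within)
    show "cmod (deriv f \<zeta>) \<le> B / (u / 2)" using seg[OF \<zeta>] by (intro d) auto
  qed auto
  then have "cmod (f w - f (w + z)) \<le> B / (u / 2) * cmod z"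
    by (simp add: norm_minus_commute)
  also have "\<dots> \<le> B / (u / 2) * cmod z powr p"
  proof (rule mult_left_mono)
    have "cmod z powr 1 \<le> cmod z powr p"
      using True pq by (intro powr_mono') auto
    then show "cmod z \<le> cmod z powr p" by simp
  qed (use B u in auto)
  also have "\<dots> = C * (2 / u * (2 + u / 2) powr l) * (1 + cmod w) powr l * cmod z powr p"
    using u by (simp add: B_def powr_mult)
  also have "\<dots> \<le> C * (2 / u * (2 + u / 2) powr l + 1 + 2 powr l) * (1 + cmod w) powr l * (cmod z powr p + cmod z powr q)"
    using C u by (intro mult_mono mult_nonneg_nonneg add_nonneg_nonneg) auto
  finally show ?thesis .
next
  case False
  have "cmod (f w) \<le> C * (1 + cmod w) powr l"
    using u by (intro growth) auto
  moreover have "cmod (f (w + z)) \<le> C * ((1 + cmod w) * (2 * cmod z)) powr l"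
  proof -
    have "cmod (f (w + z)) \<le> C * (1 + cmod (w + z)) powr l"
      using u z by (intro growth) auto
    also have "\<dots> \<le> C * ((1 + cmod w) * (2 * cmod z)) powr l"
    proof (intro mult_left_mono powr_mono2 C l)
      have "1 + cmod (w + z) \<le> 1 + cmod w + cmod z" using norm_triangle_ineq[of w z] by simp
      also have "\<dots> \<le> (1 + cmod w) * (1 + cmod z)" by (simp add: algebra_simps)
      also have "\<dots> \<le> (1 + cmod w) * (2 * cmod z)" using False by (intro mult_left_mono) auto
      finally show "1 + cmod (w + z) \<le> (1 + cmod w) * (2 * cmod z)" .
    qed simp
    finally show ?thesis .
  qed
  ultimately have "cmod (f w - f (w + z)) \<le> C * (1 + cmod w) powr l + C * ((1 + cmod w) * (2 * cmod z)) powr l"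
    using norm_triangle_ineq4[of "f w" "f (w + z)"] by linarith
  also have "\<dots> = C * (1 + 2 powr l * cmod z powr l) * (1 + cmod w) powr l"
  proof -
    have "((1 + cmod w) * (2 * cmod z)) powr l = (1 + cmod w) powr l * (2 powr l * cmod z powr l)"
      by (simp only: powr_mult)
    then show ?thesis by (simp only:) (simp add: algebra_simps)
  qed
  also have "\<dots> \<le> C * ((1 + 2 powr l) * cmod z powr q) * (1 + cmod w) powr l"
  proof (intro mult_right_mono mult_left_mono C)
    have "1 \<le> cmod z powr q" using False pq l by (intro ge_one_powr_ge_zero) auto
    moreover have "2 powr l * cmod z powr l \<le> 2 powr l * cmod z powr q"
      using False pq by (intro mult_left_mono powr_mono) auto
    ultimately show "1 + 2 powr l * cmod z powr l \<le> (1 + 2 powr l) * cmod z powr q"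
      unfolding distrib_right mult_1_left by (rule add_mono)
  qed simp
  also have "\<dots> = C * (1 + 2 powr l) * (1 + cmod w) powr l * cmod z powr q" by simp
  also have "\<dots> \<le> C * (2 / u * (2 + u / 2) powr l + 1 + 2 powr l) * (1 + cmod w) powr l * (cmod z powr p + cmod z powr q)"
    using C u by (intro mult_mono mult_nonneg_nonneg add_nonneg_nonneg) auto
  finally show ?thesis .
qed

lemma riesz_mean_error_bound:
  assumes lam: "frequency lam" and germ: "riesz_germ lam a f"
    and hol: "f holomorphic_on right_halfplane 0"
    and growth: "\<And>s. 0 < Re s \<Longrightarrow> cmod (f s) \<le> C * (1 + cmod s) powr l"
    and C: "0 \<le> C" and l: "0 \<le> l" and k: "l < k" and w: "0 < Re w" and x: "0 < x"
    and pq: "p < k" "q < k" and D: "0 \<le> D"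
    and incr: "\<And>z. 0 < Re z \<Longrightarrow> cmod (f w - f (w + z)) \<le> D * (cmod z powr p + cmod z powr q)"
  shows "cmod (f w - riesz_mean lam a k x w)
    \<le> D * exp 1 / cmod (perron_kernel k 1 1) *
      (x powr - p * (LINT t|lborel. cmod (Complex 1 t) powr - (k + 1 - p))
       + x powr - q * (LINT t|lborel. cmod (Complex 1 t) powr - (k + 1 - q)))"
proof -
  let ?I = "perron_kernel k 1 1"
  define J where "J = (\<lambda>p. LINT t|lborel. cmod (Complex 1 t) powr - (k + 1 - p))"
  define c where "c = 1 / x"
  have c: "0 < c" "x * c = 1" using x by (auto simp: c_def)
  have k0: "0 < k" using k l by simp
  let ?E = "\<lambda>t. exp (of_real x * Complex c t) * Complex c t powr of_real (- k - 1)"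
  let ?V = "\<lambda>p t. cmod (Complex c t) powr - (k + 1 - p)"
  have E: "cmod (?E t) = exp 1 * cmod (Complex c t) powr - (k + 1)" for t
    unfolding cmod_perron_integrand using c by simp
  have V_int: "integrable lborel (?V p)" if "p < k" for p
    by (rule integrable_cmod_line_powr) (use that c in auto)
  \<comment> \<open>The exponent of c is 1 - (k + 1 - p) = p - k, which gives x^(k-p); division by
    x^k later leaves x^-p.\<close>
  have V_val: "(LINT t|lborel. ?V p t) = x powr (k - p) * J p" for p
    unfolding J_def using c x by (subst integral_cmod_line_powr_scale) (auto simp: c_def powr_divide powr_minus_divide[symmetric])
  have i1: "integrable lborel (\<lambda>t. f w * ?E t)"
    using perron_kernel_integrable[OF k0 c(1)] by simp
  have i2: "integrable lborel (\<lambda>t. f (w + Complex c t) * ?E t)"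
    by (rule perron_integrand_integrable[OF hol w c(1) k polynomial_growth_shift[OF growth w c(1) _ l C]]) auto
  have "?I * of_real (x powr k) * (f w - riesz_mean lam a k x w)
      = f w * perron_kernel k c x - ?I * (riesz_mean lam a k x w * of_real (x powr k))"
    using x perron_kernel_eq[OF k0 c(1), of x] by (simp add: algebra_simps)
  also have "\<dots> = f w * perron_kernel k c x - perron_integral f w k c x"
    unfolding riesz_mean_eq_sum_power[OF x] riesz_sum_def[symmetric]
    using perron_formula[OF lam germ hol growth C l k w c(1) x] by simp
  also have "\<dots> = (LINT t|lborel. (f w - f (w + Complex c t)) * ?E t)"
    unfolding perron_kernel_def perron_integral_def left_diff_distrib
    using i1 i2 by (subst Bochner_Integration.integral_diff) auto
  finally have "cmod (?I * of_real (x powr k) * (f w - riesz_mean lam a k x w))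
      = cmod (LINT t|lborel. (f w - f (w + Complex c t)) * ?E t)" by simp
  also have "\<dots> \<le> (LINT t|lborel. D * exp 1 * (?V p t + ?V q t))"
  proof (rule order_trans[OF integral_norm_bound integral_mono])
    show "integrable lborel (\<lambda>t. cmod ((f w - f (w + Complex c t)) * ?E t))"
      unfolding left_diff_distrib by (rule Bochner_Integration.integrable_norm[OF Bochner_Integration.integrable_diff[OF i1 i2]])
    show "integrable lborel (\<lambda>t. D * exp 1 * (?V p t + ?V q t))"
      using V_int pq by simp
    fix t
    have "cmod ((f w - f (w + Complex c t)) * ?E t)
        \<le> D * (cmod (Complex c t) powr p + cmod (Complex c t) powr q) * (exp 1 * cmod (Complex c t) powr - (k + 1))"
      unfolding norm_mult[of "f w - f (w + Complex c t)"] E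
      by (rule mult_right_mono[OF incr]) (use c in auto)
    also have "\<dots> = D * exp 1 * (cmod (Complex c t) powr p * cmod (Complex c t) powr - (k + 1)
        + cmod (Complex c t) powr q * cmod (Complex c t) powr - (k + 1))"
      by (simp add: algebra_simps)
    also have "\<dots> = D * exp 1 * (?V p t + ?V q t)"
      unfolding powr_add[symmetric] by (simp add: algebra_simps)
    finally show "cmod ((f w - f (w + Complex c t)) * ?E t) \<le> D * exp 1 * (?V p t + ?V q t)" .
  qed
  also have "\<dots> = D * exp 1 * (x powr (k - p) * J p + x powr (k - q) * J q)"
    by (simp only: integral_mult_right_zero Bochner_Integration.integral_add[OF V_int[OF pq(1)] V_int[OF pq(2)]] V_val)
  also have "\<dots> = D * exp 1 * (x powr - p * J p + x powr - q * J q) * x powr k"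
    by (simp add: powr_diff powr_minus divide_inverse algebra_simps)
  finally have "cmod ?I * cmod (f w - riesz_mean lam a k x w) * x powr k
      \<le> D * exp 1 * (x powr - p * J p + x powr - q * J q) * x powr k"
    by (simp add: norm_mult mult_ac)
  then have "cmod (f w - riesz_mean lam a k x w) * cmod ?I \<le> D * exp 1 * (x powr - p * J p + x powr - q * J q)"
    using x by (simp add: mult.commute)
  then show ?thesis
    using perron_kernel_nonzero[OF k0] unfolding J_def by (simp add: pos_le_divide_eq)
qed

lemma norm_inf_le_imp_growth:
  assumes "norm_inf l f \<le> ennreal C" "0 \<le> C" "0 < Re s"
  shows "cmod (f s) \<le> C * (1 + cmod s) powr l"
proof -
  have "ennreal (cmod (f s) / (1 + cmod s) powr l) \<le> norm_inf l f"
    unfolding norm_inf_def by (rule SUP_upper) (use assms in \<open>simp add: right_halfplane_def\<close>)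
  also note assms(1)
  finally have "cmod (f s) / (1 + cmod s) powr l \<le> C"
    using assms(2) by (simp only: ennreal_le_iff)
  moreover have "0 < 1 + cmod s" by (simp add: add_pos_nonneg)
  ultimately show ?thesis by (simp add: pos_divide_le_eq)
qed

theorem theorem3p7:
  fixes lam :: "nat \<Rightarrow> real" and k l \<epsilon> u :: real and M :: "(complex \<Rightarrow> complex) set"
  assumes "frequency lam"
    and "0 \<le> l" and "l < k"
    and "M \<subseteq> H_inf lam l"
    and "\<exists>C::real. \<forall>f\<in>M. norm_inf l f \<le> ennreal C"
    and "0 < \<epsilon>" and "0 < u"
  shows "\<exists>x0>0. (SUP x\<in>{x0<..}. SUP f\<in>M.
           norm_inf l (\<lambda>s. f (of_real u + s) - riesz_mean_of lam k x f (of_real u + s)))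
         \<le> ennreal \<epsilon>"
proof -
  obtain C0 where C0: "\<And>f. f \<in> M \<Longrightarrow> norm_inf l f \<le> ennreal C0"
    using assms(5) by blast
  \<comment> \<open>The constant of the hypothesis may be negative, in which case
    \<open>ennreal\<close> sends it to 0.\<close>
  define C where "C = max C0 0"
  have C: "0 \<le> C" by (simp add: C_def)
  have growth: "cmod (f s) \<le> C * (1 + cmod s) powr l" if "f \<in> M" "0 < Re s" for f s
    using C0[OF that(1)] that C
    by (intro norm_inf_le_imp_growth) (auto simp: C_def max_def ennreal_neg)
  \<comment> \<open>k / 2 keeps p positive and strictly below k even when k is small; the maximum
    keeps q positive when l = 0, so that both powers of x decay.\<close>
  define p where "p = min 1 (k / 2)"
  define q where "q = max l p"
  have pq: "0 < p" "p \<le> 1" "p < k" "l \<le> q" "0 < q" "q < k"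
    using assms(2,3) by (auto simp: p_def q_def)
  define J where "J = (\<lambda>p. LINT t|lborel. cmod (Complex 1 t) powr - (k + 1 - p))"
  define A where "A = C * (2 / u * (2 + u / 2) powr l + 1 + 2 powr l)"
  have A: "0 \<le> A" using C assms(7) by (auto simp: A_def intro!: mult_nonneg_nonneg)
  \<comment> \<open>The majorant is independent of f and s, so a single x0 serves all of them; (1 +
    u)^l comes from 1 + |u + s| <= (1 + u) (1 + |s|), which moves the weight from u + s to
    s.\<close>
  define e where "e = (\<lambda>x. A * (1 + u) powr l * exp 1 / cmod (perron_kernel k 1 1) * (x powr - p * J p + x powr - q * J q))"
  have "(e \<longlongrightarrow> A * (1 + u) powr l * exp 1 / cmod (perron_kernel k 1 1) * (0 * J p + 0 * J q)) at_top"
    unfolding e_def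
    by (intro tendsto_mult tendsto_add tendsto_const tendsto_neg_powr filterlim_ident) (use pq in auto)
  then have "eventually (\<lambda>x. e x < \<epsilon>) at_top"
    by (rule order_tendstoD) (use assms(6) in simp)
  then obtain x1 where x1: "\<And>x. x1 \<le> x \<Longrightarrow> e x < \<epsilon>"
    by (auto simp: eventually_at_top_linorder)
  \<comment> \<open>The maximum with 1 makes x0, and hence every x > x0, positive, as Perron's
    formula requires.\<close>
  have bound: "norm_inf l (\<lambda>s. f (of_real u + s) - riesz_mean_of lam k x f (of_real u + s)) \<le> ennreal \<epsilon>"
    if f: "f \<in> M" and x: "max x1 1 < x" for f x
    unfolding norm_inf_def
  proof (rule SUP_least)
    fix s assume s: "s \<in> right_halfplane 0"
    define w where "w = of_real u + s"
    have w: "u \<le> Re w" "0 < Re w" using s assms(7) by (auto simp: w_def right_halfplane_def)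
    have hol: "f holomorphic_on right_halfplane 0" and "\<exists>a. riesz_germ lam a f"
      using f assms(4) by (auto simp: H_inf_def)
    then obtain a where germ: "riesz_germ lam a f" by blast
    \<comment> \<open>Uniqueness of the germ identifies the \<open>THE\<close> in
      \<open>riesz_coeff\<close> with the sequence at hand.\<close>
    have a: "riesz_coeff lam f = a"
      unfolding riesz_coeff_def
    proof (rule the_equality)
      show "riesz_germ lam a f" by (rule germ)
      show "b = a" if "riesz_germ lam b f" for b
        by (rule riesz_germ_unique[OF assms(1) that germ hol growth[OF f] C assms(2)])
    qed
    have "cmod (f w - riesz_mean_of lam k x f w)
        \<le> A * (1 + cmod w) powr l * exp 1 / cmod (perron_kernel k 1 1) * (x powr - p * J p + x powr - q * J q)"
      unfolding riesz_mean_of_def a J_def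
    proof (rule riesz_mean_error_bound[OF assms(1) germ hol growth[OF f] C assms(2,3)])
      show "cmod (f w - f (w + z)) \<le> A * (1 + cmod w) powr l * (cmod z powr p + cmod z powr q)"
        if "0 < Re z" for z
        unfolding A_def using that
        by (intro increment_bound[OF hol growth[OF f] C assms(2,7) w(1) _ pq(1,2,4)])
    qed (use w x pq A in auto)
    also have "\<dots> \<le> A * ((1 + u) * (1 + cmod s)) powr l * exp 1 / cmod (perron_kernel k 1 1) * (x powr - p * J p + x powr - q * J q)"
    proof (intro mult_right_mono divide_right_mono mult_left_mono A powr_mono2 assms(2))
      have "cmod w \<le> u + cmod s"
        using norm_triangle_ineq[of "of_real u" s] assms(7) by (simp add: w_def)
      also have "1 + (u + cmod s) \<le> (1 + u) * (1 + cmod s)" using assms(7) by (simp add: algebra_simps)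
      finally show "1 + cmod w \<le> (1 + u) * (1 + cmod s)" by simp
    qed (auto simp: J_def)
    also have "\<dots> = e x * (1 + cmod s) powr l"
      using assms(7) by (simp add: e_def powr_mult)
    also have "\<dots> \<le> \<epsilon> * (1 + cmod s) powr l"
      using x1[of x] x by (intro mult_right_mono) auto
    finally have "cmod (f w - riesz_mean_of lam k x f w) \<le> \<epsilon> * (1 + cmod s) powr l" .
    moreover have "0 < (1 + cmod s) powr l" using add_pos_nonneg[of 1 "cmod s"] by simp
    ultimately have "cmod (f w - riesz_mean_of lam k x f w) / (1 + cmod s) powr l \<le> \<epsilon>"
      by (simp add: pos_divide_le_eq)
    then show "ennreal (cmod (f (of_real u + s) - riesz_mean_of lam k x f (of_real u + s)) / (1 + cmod s) powr l) \<le> ennreal \<epsilon>"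
      unfolding w_def by (rule ennreal_leI)
  qed
  show ?thesis
    by (intro exI[of _ "max x1 1"] conjI SUP_least bound) auto
qed

end
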